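(* Let $P$ be an ordinary point that does not lie on the extended sides of triangle $ABC$ or of its anticomplementary triangle, does not lie on a median of $ABC$, and whose isotomic conjugate $P'$ is ordinary (i.e. $P\notin\iota(l_\infty)$). Then the center $Z$ of the conic $\mathcal{C}_P$ is given by $Z=GV\cdot T_P(GV)$. If $\mathcal{C}_P$ is a parabola or an ellipse, $Z$ is the unique fixed point in the extended plane of the affine mapping $\lambda=T_{P'}\circ T_P^{-1}$. If $\mathcal{C}_P$ is a hyperbola, then besides $Z$ the infinite points on the asymptotes of $\mathcal{C}_P$ are also fixed by $\lambda$, and these are the only other invariant points of $\lambda$.
   Context: Work in the extended Euclidean plane: the Euclidean plane together with the line at infinity $l_\infty$. Points on $l_\infty$ are called infinite, all other points ordinary; affine maps are extended to $l_\infty$. $XY$ denotes the line through $X$ and $Y$, and $l\cdot m$ the intersection point of lines $l$ and $m$. $ABC$ is a (nondegenerate) triangle with centroid $G$; medians are the full lines $AG,BG,CG$. $K$ is the homothety with center $G$ and ratio $-1/2$; the anticomplementary triangle is $K^{-1}(ABC)$. $D=AP\cdot BC$, $E=BP\cdot CA$, $F=CP\cdot AB$ are the traces of $P$, and $D_3,E_3,F_3$ are their reflections in the midpoints of $BC,CA,AB$ respectively; the lines $AD_3,BE_3,CF_3$ meet in the isotomic conjugate $P'=\iota(P)$ of $P$. Put $Q=K(P')$, $Q'=K(P)$, $V=PQ\cdot P'Q'$. $T_P$ is the unique affine map with $A\mapsto D$, $B\mapsto E$, $C\mapsto F$; $T_{P'}$ is the unique affine map with $A\mapsto D_3$, $B\mapsto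 E_3$, $C\mapsto F_3$. $\mathcal{C}_P$ is the (nondegenerate) conic through $A,B,C,P,Q$; it also passes through $P'$ and $Q'$. The center of a conic is the pole of $l_\infty$ with respect to the conic (so for a parabola it is the infinite point of the parabola). *)

theory Defs
  imports "HOL-Analysis.Analysis"
begin

(* The extended plane is the real projective plane: a point is a nonzero vector of homogeneous
   coordinates up to scaling.  The plane real^2 sits inside it as the points [x : y : 1]. *)

definition proj_eq :: "real^3 \<Rightarrow> real^3 \<Rightarrow> bool" where
  "proj_eq u v \<longleftrightarrow> u \<noteq> 0 \<and> v \<noteq> 0 \<and> (\<exists>c. v = c *\<^sub>R u)"

lemma part_equivp_proj_eq: "part_equivp proj_eq"
proof (rule part_equivpI)
  show "\<exists>x. proj_eq x x"
  proof
    have "axis 1 1 \<noteq> (0::real^3)" by (simp add: axis_eq_0_iff)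
    moreover have "axis 1 1 = 1 *\<^sub>R (axis 1 1 :: real^3)" by simp
    ultimately show "proj_eq (axis 1 1) (axis 1 1)" unfolding proj_eq_def by blast
  qed
  show "symp proj_eq"
  proof (rule sympI)
    fix u v :: "real^3" assume "proj_eq u v"
    then obtain c where c: "u \<noteq> 0" "v \<noteq> 0" "v = c *\<^sub>R u" by (auto simp: proj_eq_def)
    then have "c \<noteq> 0" by auto
    with c(3) have "u = inverse c *\<^sub>R v" by simp
    with c show "proj_eq v u" unfolding proj_eq_def by blast
  qed
  show "transp proj_eq"
  proof (rule transpI)
    fix u v w :: "real^3" assume "proj_eq u v" "proj_eq v w"
    then obtain c d where "u \<noteq> 0" "w \<noteq> 0" "v = c *\<^sub>R u" "w = d *\<^sub>R v"
      unfolding proj_eq_def by blast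
    then have "u \<noteq> 0" "w \<noteq> 0" "w = (d * c) *\<^sub>R u" by simp_all
    then show "proj_eq u w" unfolding proj_eq_def by blast
  qed
qed

quotient_type epoint = "real^3" / partial: proj_eq
  by (rule part_equivp_proj_eq)

definition pt :: "real^2 \<Rightarrow> epoint" where
  "pt x = abs_epoint (vector [x$1, x$2, 1])"

definition line_inf :: "epoint set" where
  "line_inf = {X. rep_epoint X $ 3 = 0}"

definition ordinary :: "epoint \<Rightarrow> bool" where
  "ordinary X \<longleftrightarrow> X \<notin> line_inf"

(* The line XY; only meaningful for distinct X and Y. *)
definition join :: "epoint \<Rightarrow> epoint \<Rightarrow> epoint set" where
  "join X Y = {Z. rep_epoint Z \<in> span {rep_epoint X, rep_epoint Y}}"

(* The intersection point of two distinct lines. *)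
definition meet :: "epoint set \<Rightarrow> epoint set \<Rightarrow> epoint" where
  "meet l m = (THE X. l \<inter> m = {X})"

definition affine_map :: "(real^2 \<Rightarrow> real^2) \<Rightarrow> bool" where
  "affine_map f \<longleftrightarrow> linear (\<lambda>x. f x - f 0)"

(* For f x = L x + b with L linear and bijective, the extension of f to the extended plane is
   [v : w] |-> [L v + w b : w]; here L v = f v - f 0 and b = f 0. *)
definition extend_affine :: "(real^2 \<Rightarrow> real^2) \<Rightarrow> epoint \<Rightarrow> epoint" where
  "extend_affine f X =
     (let u = rep_epoint X; v = vector [u$1, u$2]; w = u$3;
          y = (f v - f 0) + w *\<^sub>R f 0
      in abs_epoint (vector [y$1, y$2, w]))"

definition centroid :: "real^2 \<Rightarrow> real^2 \<Rightarrow> real^2 \<Rightarrow> real^2" where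
  "centroid A B C = (1/3) *\<^sub>R (A + B + C)"

definition homothety :: "real^2 \<Rightarrow> real \<Rightarrow> real^2 \<Rightarrow> real^2" where
  "homothety g r x = g + r *\<^sub>R (x - g)"

(* The complement map K of the triangle. *)
definition compl_map :: "real^2 \<Rightarrow> real^2 \<Rightarrow> real^2 \<Rightarrow> real^2 \<Rightarrow> real^2" where
  "compl_map A B C = homothety (centroid A B C) (-1/2)"

(* The union of the three side lines of the triangle. *)
definition side_lines :: "real^2 \<Rightarrow> real^2 \<Rightarrow> real^2 \<Rightarrow> epoint set" where
  "side_lines A B C = join (pt B) (pt C) \<union> join (pt C) (pt A) \<union> join (pt A) (pt B)"

(* The union of the three medians. *)
definition medians :: "real^2 \<Rightarrow> real^2 \<Rightarrow> real^2 \<Rightarrow> epoint set" where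
  "medians A B C = (let G = pt (centroid A B C)
     in join (pt A) G \<union> join (pt B) G \<union> join (pt C) G)"

(* The trace AX.BC; the traces on the other sides are obtained by permuting A, B, C. *)
definition trace_pt :: "real^2 \<Rightarrow> real^2 \<Rightarrow> real^2 \<Rightarrow> epoint \<Rightarrow> epoint" where
  "trace_pt A B C X = meet (join (pt A) X) (join (pt B) (pt C))"

(* The reflection of AX.BC in the midpoint of BC; x |-> B + C - x is that point reflection. *)
definition refl_trace :: "real^2 \<Rightarrow> real^2 \<Rightarrow> real^2 \<Rightarrow> epoint \<Rightarrow> epoint" where
  "refl_trace A B C X = extend_affine (\<lambda>x. B + C - x) (trace_pt A B C X)"

definition isotomic :: "real^2 \<Rightarrow> real^2 \<Rightarrow> real^2 \<Rightarrow> epoint \<Rightarrow> epoint" where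
  "isotomic A B C X = (THE Y. Y \<in> join (pt A) (refl_trace A B C X) \<and>
                              Y \<in> join (pt B) (refl_trace B C A X) \<and>
                              Y \<in> join (pt C) (refl_trace C A B X))"

(* The affine map taking the triangle ABC to the ordinary points D, E, F. *)
definition affine_to ::
  "real^2 \<Rightarrow> real^2 \<Rightarrow> real^2 \<Rightarrow> epoint \<Rightarrow> epoint \<Rightarrow> epoint \<Rightarrow> real^2 \<Rightarrow> real^2" where
  "affine_to A B C D E F = (THE f. affine_map f \<and> pt (f A) = D \<and> pt (f B) = E \<and> pt (f C) = F)"

(* Conics are point sets.  A nonempty nondegenerate real conic determines its symmetric
   matrix up to a nonzero factor, so polarity does not depend on the matrix chosen. *)
definition conic_matrix :: "real^3^3 \<Rightarrow> epoint set \<Rightarrow> bool" where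
  "conic_matrix M c \<longleftrightarrow> transpose M = M \<and> invertible M \<and>
     c = {X. rep_epoint X \<bullet> (M *v rep_epoint X) = 0}"

definition nondeg_conic :: "epoint set \<Rightarrow> bool" where
  "nondeg_conic c \<longleftrightarrow> c \<noteq> {} \<and> (\<exists>M. conic_matrix M c)"

definition polar :: "epoint set \<Rightarrow> epoint \<Rightarrow> epoint set" where
  "polar c X = {Y. \<exists>M. conic_matrix M c \<and> rep_epoint X \<bullet> (M *v rep_epoint Y) = 0}"

definition pole :: "epoint set \<Rightarrow> epoint set \<Rightarrow> epoint" where
  "pole c l = (THE X. polar c X = l)"

definition conic_center :: "epoint set \<Rightarrow> epoint" where
  "conic_center c = pole c line_inf"

definition conic_through :: "epoint set \<Rightarrow> epoint set" where
  "conic_through S = (THE c. nondeg_conic c \<and> S \<subseteq> c)"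

definition is_ellipse :: "epoint set \<Rightarrow> bool" where
  "is_ellipse c \<longleftrightarrow> nondeg_conic c \<and> c \<inter> line_inf = {}"

definition is_parabola :: "epoint set \<Rightarrow> bool" where
  "is_parabola c \<longleftrightarrow> nondeg_conic c \<and> card (c \<inter> line_inf) = 1"

definition is_hyperbola :: "epoint set \<Rightarrow> bool" where
  "is_hyperbola c \<longleftrightarrow> nondeg_conic c \<and> card (c \<inter> line_inf) = 2"

(* The asymptotes are the tangents at the infinite points, other than the line at infinity;
   the tangent at a point of the conic is its polar. *)
definition asymptote :: "epoint set \<Rightarrow> epoint set \<Rightarrow> bool" where
  "asymptote c l \<longleftrightarrow> l \<noteq> line_inf \<and> (\<exists>X \<in> c \<inter> line_inf. l = polar c X)"

end

theory Submission
  imports Defs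
begin

text \<open>
  In homogeneous barycentric coordinates relative to \<open>ABC\<close> every object of the configuration is
  polynomial in \<open>P = (p : q : r)\<close>: \<open>P' = (qr : rp : pq)\<close>, the map \<open>K\<close> is
  \<open>(x : y : z) \<mapsto> (y + z : z + x : x + y)\<close>, lines are linear forms, \<open>XY\<close> and \<open>l\<cdot>m\<close> are cross
  products, and the line at infinity is \<open>x + y + z = 0\<close>. The conic through \<open>A, B, C, P, Q\<close> is
  \<open>p(q\<^sup>2 - r\<^sup>2) yz + q(r\<^sup>2 - p\<^sup>2) zx + r(p\<^sup>2 - q\<^sup>2) xy = 0\<close>, and the pole of the line at infinity
  is \<open>Z = (p(q - r)\<^sup>2 : q(r - p)\<^sup>2 : r(p - q)\<^sup>2)\<close>.

  The point \<open>Z\<close> lies on \<open>GV\<close> and on \<open>T\<^sub>P(GV)\<close>. These lines are different because the cross product of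
  their coordinate vectors is \<open>(p - q)(q - r)(r - p)(qr + rp + pq)(p + q + r)\<close> times the vector of
  \<open>Z\<close> (\<open>lGV_cross_lTGV\<close>), and the factors are nonzero since \<open>P\<close> is on no median and both \<open>P'\<close> and
  \<open>P\<close> are ordinary.

  For the fixed points of \<open>\<lambda>\<close>, take the point with coordinates
  \<open>((q + r) w\<^sub>1 : (r + p) w\<^sub>2 : (p + q) w\<^sub>3)\<close>. The map \<open>T\<^sub>P\<close> sends it to
  \<open>x = (p(w\<^sub>2 + w\<^sub>3) : q(w\<^sub>3 + w\<^sub>1) : r(w\<^sub>1 + w\<^sub>2))\<close> and the second affine map sends it to
  \<open>x' = (r w\<^sub>2 + q w\<^sub>3 : p w\<^sub>3 + r w\<^sub>1 : q w\<^sub>1 + p w\<^sub>2)\<close>, so \<open>\<lambda>\<close> sends \<open>x\<close> to \<open>x'\<close>, and \<open>x\<close> is fixed iff the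
  two vectors are proportional. They have the same coordinate sum.

  If this sum is nonzero, proportional means equal, that is,
  \<open>(q - r) w\<^sub>1 = (r - p) w\<^sub>2 = (p - q) w\<^sub>3\<close>, and the only solution is \<open>x = Z\<close> (a solution also when \<open>Z\<close> is infinite). If the sum is zero, both
  vectors lie in the plane \<open>x + y + z = 0\<close>, so their cross product is a multiple of \<open>(1, 1, 1)\<close>. The
  factor is a quadratic form in \<open>w\<close> which modulo the coordinate sum is the equation of the conic
  (\<open>fixed_infinite\<close>, \<open>conic_TP_coords\<close>), so the infinite fixed points are exactly the infinite points
  of the conic. Hence the fixed points are always \<open>Z\<close> together with the infinite points of the conic
  (\<open>lam_fixed_points\<close>). An ellipse has no infinite point; a parabola has one, at which the line at
  infinity is tangent, so that it is the center; and the infinite points of a hyperbola are those on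
  its asymptotes.
\<close>

unbundle cross3_syntax

section \<open>Homogeneous coordinates and affine maps\<close>

lemma vec3_eq_iff: "u = v \<longleftrightarrow> u $ 1 = v $ 1 \<and> u $ 2 = v $ 2 \<and> u $ 3 = v $ 3" for u v :: "real^3"
  by (simp add: vec_eq_iff forall_3)

lemma inner_vec3: "u \<bullet> v = u $ 1 * v $ 1 + u $ 2 * v $ 2 + u $ 3 * v $ 3" for u v :: "real^3"
  by (simp add: inner_vec_def sum_3)

lemma vector_components [simp]: "vector [u $ 1, u $ 2, u $ 3] = u" for u :: "real^3"
  by (simp add: vec3_eq_iff)

lemmas coords = vec3_eq_iff inner_vec3 cross_components vector_3

lemma cross_eq_0_iff_scaleR:
  assumes "u \<noteq> 0" "v \<noteq> 0"
  shows "u \<times> v = 0 \<longleftrightarrow> (\<exists>c. c \<noteq> 0 \<and> v = c *\<^sub>R u)"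
  using assms unfolding cross_eq_0 collinear_lemma by auto

text \<open>The expansion of \<open>w\<close> in the basis \<open>u\<close>, \<open>v\<close>, \<open>u \<times> v\<close>, cleared of the denominator. It turns
orthogonality to \<open>u \<times> v\<close> into membership in the span of \<open>u\<close> and \<open>v\<close>, and orthogonality to \<open>u\<close> and
\<open>v\<close> into proportionality to \<open>u \<times> v\<close>.\<close>

lemma reciprocal_basis:
  "((u \<times> v) \<bullet> (u \<times> v)) *\<^sub>R w =
    (w \<bullet> (v \<times> (u \<times> v))) *\<^sub>R u + (w \<bullet> ((u \<times> v) \<times> u)) *\<^sub>R v + (w \<bullet> (u \<times> v)) *\<^sub>R (u \<times> v)"
  unfolding coords by (simp add: coords) algebra

lemma span_pair_iff:
  assumes "u \<times> v \<noteq> 0"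
  shows "w \<in> span {u, v} \<longleftrightarrow> w \<bullet> (u \<times> v) = 0"
proof
  assume "w \<in> span {u, v}"
  then obtain a b where "w = a *\<^sub>R u + b *\<^sub>R v"
    by (auto simp: span_insert algebra_simps)
  then show "w \<bullet> (u \<times> v) = 0"
    by (simp add: inner_add_left dot_cross_self)
next
  assume "w \<bullet> (u \<times> v) = 0"
  define k where "k = (u \<times> v) \<bullet> (u \<times> v)"
  have "k \<noteq> 0" using assms by (simp add: k_def)
  have "k *\<^sub>R w = (w \<bullet> (v \<times> (u \<times> v))) *\<^sub>R u + (w \<bullet> ((u \<times> v) \<times> u)) *\<^sub>R v"
    using reciprocal_basis[of u v w] \<open>w \<bullet> (u \<times> v) = 0\<close> by (simp add: k_def)
  then have "k *\<^sub>R w \<in> span {u, v}"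
    by (simp add: span_add span_base span_scale)
  then have "inverse k *\<^sub>R k *\<^sub>R w \<in> span {u, v}" by (rule span_scale)
  with \<open>k \<noteq> 0\<close> show "w \<in> span {u, v}" by simp
qed

lemma orthogonal_pair_imp_cross:
  assumes "u \<times> v \<noteq> 0" "w \<bullet> u = 0" "w \<bullet> v = 0"
  shows "\<exists>c. w = c *\<^sub>R (u \<times> v)"
proof -
  define k where "k = (u \<times> v) \<bullet> (u \<times> v)"
  have "k \<noteq> 0" using assms by (simp add: k_def)
  have "w \<bullet> (v \<times> (u \<times> v)) = 0" "w \<bullet> ((u \<times> v) \<times> u) = 0"
    using assms(2,3) by (simp_all add: coords; algebra)+
  then have "k *\<^sub>R w = (w \<bullet> (u \<times> v)) *\<^sub>R (u \<times> v)"
    using reciprocal_basis[of u v w] by (simp add: k_def)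
  then have "inverse k *\<^sub>R k *\<^sub>R w = (inverse k * (w \<bullet> (u \<times> v))) *\<^sub>R (u \<times> v)" by simp
  with \<open>k \<noteq> 0\<close> show ?thesis by auto
qed

lemma rep_epoint_nonzero: "rep_epoint X \<noteq> 0"
  using Quotient3_rel_rep[OF Quotient3_epoint, of X X] by (auto simp: proj_eq_def)

lemma abs_rep_epoint: "abs_epoint (rep_epoint X) = X"
  using Quotient3_abs_rep[OF Quotient3_epoint] by simp

lemma abs_epoint_eq_iff:
  assumes "u \<noteq> 0" "v \<noteq> 0"
  shows "abs_epoint u = abs_epoint v \<longleftrightarrow> (\<exists>c. v = c *\<^sub>R u)"
proof -
  have "proj_eq u u" "proj_eq v v"
    using assms by (auto simp: proj_eq_def intro: exI[of _ 1])
  then have "proj_eq u v \<longleftrightarrow> abs_epoint u = abs_epoint v"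
    using Quotient3_rel[OF Quotient3_epoint, of u v] by blast
  with assms show ?thesis by (auto simp: proj_eq_def)
qed

lemma rep_abs_epoint:
  assumes "u \<noteq> 0"
  obtains c where "c \<noteq> 0" "rep_epoint (abs_epoint u) = c *\<^sub>R u"
proof -
  have "abs_epoint u = abs_epoint (rep_epoint (abs_epoint u))"
    by (simp add: abs_rep_epoint)
  then obtain c where "rep_epoint (abs_epoint u) = c *\<^sub>R u"
    using abs_epoint_eq_iff[OF assms rep_epoint_nonzero] by auto
  moreover from this have "c \<noteq> 0" using rep_epoint_nonzero[of "abs_epoint u"] by auto
  ultimately show ?thesis using that by blast
qed

definition hom :: "real^2 \<Rightarrow> real^3" where
  "hom x = vector [x$1, x$2, 1]"

lemma pt_eq_abs_hom: "pt x = abs_epoint (hom x)"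
  by (simp add: pt_def hom_def)

lemma hom_nonzero: "hom x \<noteq> 0"
  by (simp add: hom_def coords)

lemma pt_eq_iff: "pt x = pt y \<longleftrightarrow> x = y"
proof
  assume "pt x = pt y"
  then obtain c where "hom y = c *\<^sub>R hom x"
    by (auto simp: pt_eq_abs_hom abs_epoint_eq_iff hom_nonzero)
  then show "x = y" by (auto simp: hom_def coords vec_eq_iff forall_2)
qed simp

text \<open>The linear map of homogeneous coordinates that underlies \<open>extend_affine f\<close>.\<close>

definition hom_map :: "(real^2 \<Rightarrow> real^2) \<Rightarrow> real^3 \<Rightarrow> real^3" where
  "hom_map f u = (let y = (f (vector [u$1, u$2]) - f 0) + u$3 *\<^sub>R f 0 in vector [y$1, y$2, u$3])"

lemma extend_affine_rep: "extend_affine f X = abs_epoint (hom_map f (rep_epoint X))"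
  by (simp add: extend_affine_def hom_map_def Let_def)

lemma linear_hom_map:
  assumes "affine_map f"
  shows "linear (hom_map f)"
proof -
  define L where "L x = f x - f 0" for x
  have L: "linear L" using assms unfolding affine_map_def L_def by simp
  have v: "vector [a + c, b + d] = vector [a, b] + (vector [c, d] :: real^2)" for a b c d :: real
    by (simp add: vec_eq_iff forall_2)
  have s: "vector [c * a, c * b] = c *\<^sub>R (vector [a, b] :: real^2)" for a b c :: real
    by (simp add: vec_eq_iff forall_2)
  have e: "hom_map f u = (let y = L (vector [u$1, u$2]) + u$3 *\<^sub>R f 0 in vector [y$1, y$2, u$3])" for u
    by (simp add: hom_map_def L_def)
  show ?thesis
    by (rule linearI)
       (simp_all add: e v s linear_add[OF L] linear_scale[OF L] Let_def coords algebra_simps)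
qed

lemma hom_map_hom: "hom_map f (hom x) = hom (f x)"
proof -
  have "vector [x$1, x$2] = x" by (simp add: vec_eq_iff forall_2)
  then show ?thesis by (simp add: hom_map_def hom_def Let_def)
qed

lemma hom_inj: "hom x = hom y \<longleftrightarrow> x = y"
  by (auto simp: hom_def coords vec_eq_iff forall_2)

text \<open>Any representative may replace the one chosen by \<open>rep_epoint\<close>, since \<open>hom_map f\<close> is linear and so
changes only by the same factor.\<close>

lemma extend_affine_abs:
  assumes "affine_map f" "u \<noteq> 0"
  shows "extend_affine f (abs_epoint u) = abs_epoint (hom_map f u)"
proof -
  obtain c where c: "c \<noteq> 0" "rep_epoint (abs_epoint u) = c *\<^sub>R u"
    using rep_abs_epoint[OF assms(2)] .
  have e: "extend_affine f (abs_epoint u) = abs_epoint (c *\<^sub>R hom_map f u)"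
    by (simp add: extend_affine_rep c linear_scale[OF linear_hom_map[OF assms(1)]])
  show ?thesis
  proof (cases "hom_map f u = 0")
    case True
    then show ?thesis using e by simp
  next
    case False
    then have "abs_epoint (hom_map f u) = abs_epoint (c *\<^sub>R hom_map f u)"
      using c by (subst abs_epoint_eq_iff) auto
    with e show ?thesis by simp
  qed
qed

lemma affine_map_inv:
  assumes "affine_map f" "inj f"
  shows "affine_map (inv f)"
proof -
  define L where "L x = f x - f 0" for x
  have L: "linear L" using assms unfolding affine_map_def L_def by simp
  have "inj L" using assms(2) by (auto simp: L_def inj_on_def)
  then obtain g where g: "linear g" "\<And>x. g (L x) = x" "\<And>x. L (g x) = x"
    using linear_injective_isomorphism[OF L] by blast
  have "f (g (y - f 0)) = y" for y
    using g(3)[of "y - f 0"] by (simp add: L_def)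
  then have i: "inv f y = g (y - f 0)" for y
    using assms(2) by (metis inv_f_f)
  have "(\<lambda>y. inv f y - inv f 0) = g"
    by (rule ext) (simp add: i linear_diff[OF g(1)] linear_neg[OF g(1)])
  then show "affine_map (inv f)" using g by (simp add: affine_map_def)
qed

lemma affine_map_comp:
  assumes "affine_map f" "affine_map g"
  shows "affine_map (f \<circ> g)"
proof -
  define L where "L x = f x - f 0" for x
  have L: "linear L" using assms unfolding affine_map_def L_def by simp
  have "(f \<circ> g) x - (f \<circ> g) 0 = L (g x - g 0)" for x
    by (simp only: linear_diff[OF L]) (simp add: L_def)
  then have "(\<lambda>x. (f \<circ> g) x - (f \<circ> g) 0) = L \<circ> (\<lambda>x. g x - g 0)" by auto
  then show ?thesis
    using assms(2) L linear_compose unfolding affine_map_def by auto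
qed

section \<open>Barycentric coordinates\<close>

text \<open>The determinant is twice the signed area of the triangle; its vanishing makes \<open>B - A\<close> and \<open>C - A\<close>
proportional. It is what makes barycentric coordinates a coordinate system.\<close>

lemma noncollinear_imp_det_nonzero:
  fixes A B C :: "real^2"
  assumes "\<not> collinear {A, B, C}"
  shows "(B$1 - A$1) * (C$2 - A$2) - (B$2 - A$2) * (C$1 - A$1) \<noteq> 0"
proof
  assume d: "(B$1 - A$1) * (C$2 - A$2) - (B$2 - A$2) * (C$1 - A$1) = 0"
  define b where "b = B - A"
  define c where "c = C - A"
  have bc: "b$1 * c$2 = b$2 * c$1" using d by (simp add: b_def c_def)
  have "collinear {0, b, c}"
  proof (cases "b = 0")
    case True
    then show ?thesis unfolding collinear_lemma by blast
  next
    case False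
    then consider "b$1 \<noteq> 0" | "b$2 \<noteq> 0" by (auto simp: vec_eq_iff forall_2)
    then show ?thesis
    proof cases
      case 1
      then have "c$2 = c$1 / b$1 * b$2"
        using bc by (simp add: eq_divide_eq mult.commute)
      with 1 have "c = (c$1 / b$1) *\<^sub>R b"
        by (simp add: vec_eq_iff forall_2)
      then show ?thesis unfolding collinear_lemma by blast
    next
      case 2
      then have "c$1 = c$2 / b$2 * b$1"
        using bc by (simp add: eq_divide_eq mult.commute)
      with 2 have "c = (c$2 / b$2) *\<^sub>R b"
        by (simp add: vec_eq_iff forall_2)
      then show ?thesis unfolding collinear_lemma by blast
    qed
  qed
  then have "collinear {B, A, C}" by (subst collinear_3) (auto simp: b_def c_def)
  with assms show False by (simp add: insert_commute)
qed

locale triangle =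
  fixes A B C :: "real^2"
  assumes noncollinear: "\<not> collinear {A, B, C}"
begin

definition bary_hom :: "real^3 \<Rightarrow> real^3" where
  "bary_hom u = u$1 *\<^sub>R hom A + u$2 *\<^sub>R hom B + u$3 *\<^sub>R hom C"

definition bary :: "real^3 \<Rightarrow> epoint" where
  "bary u = abs_epoint (bary_hom u)"

text \<open>The line with coefficient vector \<open>n\<close> in barycentric coordinates.\<close>

definition bline :: "real^3 \<Rightarrow> epoint set" where
  "bline n = {bary u | u. u \<noteq> 0 \<and> n \<bullet> u = 0}"

lemma linear_bary_hom: "linear bary_hom"
  by (rule linearI) (simp_all add: bary_hom_def algebra_simps)

lemma bary_hom_eq_0_iff: "bary_hom u = 0 \<longleftrightarrow> u = 0"
proof
  assume "bary_hom u = 0"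
  then have e: "u$1 * A$1 + u$2 * B$1 + u$3 * C$1 = 0" "u$1 * A$2 + u$2 * B$2 + u$3 * C$2 = 0"
      "u$1 + u$2 + u$3 = 0"
    by (auto simp: bary_hom_def hom_def coords)
  define d where "d = (B$1 - A$1) * (C$2 - A$2) - (B$2 - A$2) * (C$1 - A$1)"
  \<comment> \<open>Cramer's rule: the three equations are combined with the cofactors of one column of the
    coordinate matrix.\<close>
  have "d * u$1 = (u$1 * A$1 + u$2 * B$1 + u$3 * C$1) * (B$2 - C$2)
      - (u$1 * A$2 + u$2 * B$2 + u$3 * C$2) * (B$1 - C$1) + (u$1 + u$2 + u$3) * (B$1 * C$2 - B$2 * C$1)"
    "d * u$2 = (u$1 * A$1 + u$2 * B$1 + u$3 * C$1) * (C$2 - A$2)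
      - (u$1 * A$2 + u$2 * B$2 + u$3 * C$2) * (C$1 - A$1) + (u$1 + u$2 + u$3) * (C$1 * A$2 - C$2 * A$1)"
    "d * u$3 = (u$1 * A$1 + u$2 * B$1 + u$3 * C$1) * (A$2 - B$2)
      - (u$1 * A$2 + u$2 * B$2 + u$3 * C$2) * (A$1 - B$1) + (u$1 + u$2 + u$3) * (A$1 * B$2 - A$2 * B$1)"
    unfolding d_def by (simp_all only: algebra_simps)
  then have "d * u$1 = 0" "d * u$2 = 0" "d * u$3 = 0"
    unfolding e by simp_all
  then show "u = 0"
    using noncollinear_imp_det_nonzero[OF noncollinear] by (simp add: d_def coords)
qed (simp add: bary_hom_def)

lemma inj_bary_hom: "inj bary_hom"
  using linear_injective_0[OF linear_bary_hom] bary_hom_eq_0_iff by blast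

lemma surj_bary_hom: "surj bary_hom"
  using linear_inj_imp_surj[OF linear_bary_hom inj_bary_hom] .

lemma bary_hom_scale: "bary_hom (c *\<^sub>R u) = c *\<^sub>R bary_hom u"
  by (rule linear_scale[OF linear_bary_hom])

lemma bary_hom_eq_iff: "bary_hom u = bary_hom v \<longleftrightarrow> u = v"
  using inj_bary_hom by (auto simp: inj_on_def)

lemma bary_cases:
  obtains u where "u \<noteq> 0" "X = bary u"
proof -
  obtain u where "rep_epoint X = bary_hom u" using surj_bary_hom by (metis surjD)
  then have "u \<noteq> 0" "X = bary u"
    using rep_epoint_nonzero[of X] abs_rep_epoint[of X] by (auto simp: bary_def bary_hom_eq_0_iff)
  then show ?thesis using that by blast
qed

lemma rep_bary:
  assumes "u \<noteq> 0"
  obtains c where "c \<noteq> 0" "rep_epoint (bary u) = c *\<^sub>R bary_hom u"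
  using rep_abs_epoint[of "bary_hom u"] assms by (auto simp: bary_def bary_hom_eq_0_iff)

lemma bary_eq_iff:
  assumes "u \<noteq> 0" "v \<noteq> 0"
  shows "bary u = bary v \<longleftrightarrow> u \<times> v = 0"
proof -
  have "bary u = bary v \<longleftrightarrow> (\<exists>c. v = c *\<^sub>R u)"
    using assms by (simp add: bary_def abs_epoint_eq_iff bary_hom_eq_0_iff bary_hom_scale[symmetric] bary_hom_eq_iff)
  also have "\<dots> \<longleftrightarrow> u \<times> v = 0"
    using assms by (subst cross_eq_0_iff_scaleR) auto
  finally show ?thesis .
qed

lemma bary_scale: "c \<noteq> 0 \<Longrightarrow> bary (c *\<^sub>R u) = bary u"
  by (cases "u = 0") (simp_all add: bary_eq_iff cross_mult_left)

lemma bary_eqI: "u = c *\<^sub>R v \<Longrightarrow> c \<noteq> 0 \<Longrightarrow> bary u = bary v"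
  using bary_scale by simp

lemma bary_in_bline_iff:
  assumes "u \<noteq> 0"
  shows "bary u \<in> bline n \<longleftrightarrow> n \<bullet> u = 0"
proof
  assume "bary u \<in> bline n"
  then obtain v where v: "bary u = bary v" "v \<noteq> 0" "n \<bullet> v = 0" by (auto simp: bline_def)
  then obtain c where "u = c *\<^sub>R v"
    using assms bary_eq_iff[of v u] cross_eq_0_iff_scaleR[of v u] by auto
  with v show "n \<bullet> u = 0" by simp
qed (use assms in \<open>auto simp: bline_def\<close>)

lemma bline_scale: "c \<noteq> 0 \<Longrightarrow> bline (c *\<^sub>R n) = bline n"
  by (simp add: bline_def)

lemma bline_eq_iff:
  assumes "m \<noteq> 0" "n \<noteq> 0"
  shows "bline m = bline n \<longleftrightarrow> m \<times> n = 0"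
proof
  assume eq: "bline m = bline n"
  have "n \<bullet> (m \<times> w) = 0" for w
  proof (cases "m \<times> w = 0")
    case False
    have "m \<bullet> (m \<times> w) = 0" by (simp add: dot_cross_self)
    then show ?thesis using eq False bary_in_bline_iff[OF False] by blast
  qed simp
  \<comment> \<open>This choice of \<open>w\<close> makes the left-hand side the squared norm of \<open>m \<times> n\<close>.\<close>
  from this[of "n \<times> m"] have "(m \<times> n) \<bullet> (m \<times> n) = 0"
    by (simp add: coords) algebra
  then show "m \<times> n = 0" by simp
next
  assume "m \<times> n = 0"
  then obtain c where "c \<noteq> 0" "n = c *\<^sub>R m"
    using cross_eq_0_iff_scaleR[OF assms] by blast
  then show "bline m = bline n" by (simp add: bline_scale)
qed

lemma join_bary:
  assumes "u \<times> v \<noteq> 0"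
  shows "join (bary u) (bary v) = bline (u \<times> v)"
proof -
  have nz: "u \<noteq> 0" "v \<noteq> 0" using assms by auto
  obtain a where a: "a \<noteq> 0" "rep_epoint (bary u) = a *\<^sub>R bary_hom u" using rep_bary[OF nz(1)] .
  obtain b where b: "b \<noteq> 0" "rep_epoint (bary v) = b *\<^sub>R bary_hom v" using rep_bary[OF nz(2)] .
  have span: "span {rep_epoint (bary u), rep_epoint (bary v)} = bary_hom ` span {u, v}"
  proof -
    have "span {rep_epoint (bary u), rep_epoint (bary v)} = bary_hom ` span {a *\<^sub>R u, b *\<^sub>R v}"
      using linear_span_image[OF linear_bary_hom, of "{a *\<^sub>R u, b *\<^sub>R v}"] by (simp add: a b bary_hom_scale)
    moreover have "span {a *\<^sub>R u, b *\<^sub>R v} = span {u, v}"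
    proof (rule set_eqI)
      fix w
      have "(a *\<^sub>R u) \<times> (b *\<^sub>R v) = (a * b) *\<^sub>R (u \<times> v)"
        by (simp add: cross_mult_left cross_mult_right)
      then show "w \<in> span {a *\<^sub>R u, b *\<^sub>R v} \<longleftrightarrow> w \<in> span {u, v}"
        using assms a b by (simp add: span_pair_iff)
    qed
    ultimately show ?thesis by simp
  qed
  have "bary w \<in> join (bary u) (bary v) \<longleftrightarrow> bary w \<in> bline (u \<times> v)" if w: "w \<noteq> 0" for w
  proof -
    obtain c where c: "c \<noteq> 0" "rep_epoint (bary w) = c *\<^sub>R bary_hom w" using rep_bary[OF w] .
    have "bary w \<in> join (bary u) (bary v) \<longleftrightarrow> c *\<^sub>R w \<in> span {u, v}"
      unfolding join_def mem_Collect_eq span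
      by (simp add: c inj_image_mem_iff[OF inj_bary_hom] bary_hom_scale[symmetric])
    also have "\<dots> \<longleftrightarrow> bary w \<in> bline (u \<times> v)"
      using assms w c by (simp add: span_pair_iff bary_in_bline_iff inner_commute)
    finally show ?thesis .
  qed
  then show ?thesis by (metis bary_cases set_eqI)
qed

lemma bline_Int:
  assumes "m \<times> n \<noteq> 0"
  shows "bline m \<inter> bline n = {bary (m \<times> n)}"
proof -
  have "bary w \<in> bline m \<inter> bline n \<longleftrightarrow> bary w = bary (m \<times> n)" if w: "w \<noteq> 0" for w
  proof
    assume "bary w \<in> bline m \<inter> bline n"
    then obtain c where c: "w = c *\<^sub>R (m \<times> n)"
      using orthogonal_pair_imp_cross[OF assms, of w] w by (auto simp: bary_in_bline_iff inner_commute)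
    with w have "c \<noteq> 0" by auto
    with c show "bary w = bary (m \<times> n)" by (simp add: bary_scale)
  next
    assume "bary w = bary (m \<times> n)"
    then show "bary w \<in> bline m \<inter> bline n"
      using assms by (simp add: bary_in_bline_iff dot_cross_self)
  qed
  then show ?thesis by (metis bary_cases set_eqI singleton_iff)
qed

lemma meet_bline:
  assumes "m \<times> n \<noteq> 0"
  shows "meet (bline m) (bline n) = bary (m \<times> n)"
  unfolding meet_def bline_Int[OF assms] by (rule the_equality) auto

lemma meet_bline_eqI:
  assumes "m \<times> n \<noteq> 0" "u \<noteq> 0" "m \<bullet> u = 0" "n \<bullet> u = 0"
  shows "meet (bline m) (bline n) = bary u"
proof -
  have "bary u \<in> bline m \<inter> bline n" using assms by (simp add: bary_in_bline_iff)
  then show ?thesis using bline_Int[OF assms(1)] meet_bline[OF assms(1)] by simp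
qed

lemma bline_neqI:
  assumes "m \<times> n \<noteq> 0"
  shows "bline m \<noteq> bline n"
  using assms bline_eq_iff[of m n] by (metis cross_zero_left cross_zero_right)

lemma bary_hom_3: "bary_hom u $ 3 = u$1 + u$2 + u$3"
  by (simp add: bary_hom_def hom_def)

lemma line_inf_eq: "line_inf = bline (vector [1, 1, 1])"
proof -
  have "bary w \<in> line_inf \<longleftrightarrow> bary w \<in> bline (vector [1, 1, 1])" if w: "w \<noteq> 0" for w
  proof -
    obtain c where c: "c \<noteq> 0" "rep_epoint (bary w) = c *\<^sub>R bary_hom w" using rep_bary[OF w] .
    then show ?thesis using w by (simp add: line_inf_def bary_in_bline_iff bary_hom_3 inner_vec3)
  qed
  then show ?thesis by (metis bary_cases set_eqI)
qed

lemma vertices_bary: "pt A = bary (vector [1, 0, 0])" "pt B = bary (vector [0, 1, 0])" "pt C = bary (vector [0, 0, 1])"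
  by (simp_all add: bary_def bary_hom_def pt_eq_abs_hom)

lemma bary_hom_eq_hom:
  assumes "u$1 + u$2 + u$3 = 1"
  shows "bary_hom u = hom (u$1 *\<^sub>R A + u$2 *\<^sub>R B + u$3 *\<^sub>R C)"
  using assms by (simp add: bary_hom_def hom_def coords)

lemma bary_eq_pt:
  assumes "u$1 + u$2 + u$3 = 1"
  shows "bary u = pt (u$1 *\<^sub>R A + u$2 *\<^sub>R B + u$3 *\<^sub>R C)"
  by (simp add: bary_def bary_hom_eq_hom[OF assms] pt_eq_abs_hom)

lemma pt_cases:
  obtains u where "u$1 + u$2 + u$3 = 1" "hom x = bary_hom u" "pt x = bary u"
proof -
  obtain u where u: "hom x = bary_hom u" using surj_bary_hom by (metis surjD)
  have "u$1 + u$2 + u$3 = 1" using bary_hom_3[of u] u[symmetric] by (simp add: hom_def)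
  with u show ?thesis using that by (simp add: bary_def pt_eq_abs_hom)
qed

lemma hom_map_bary_hom:
  assumes "affine_map f" "hom (f A) = bary_hom a" "hom (f B) = bary_hom b" "hom (f C) = bary_hom c"
  shows "hom_map f (bary_hom u) = bary_hom (u$1 *\<^sub>R a + u$2 *\<^sub>R b + u$3 *\<^sub>R c)"
proof -
  note L = linear_hom_map[OF assms(1)]
  show ?thesis
    unfolding bary_hom_def[of u] linear_add[OF L] linear_scale[OF L] hom_map_hom assms(2-)
    by (simp add: linear_add[OF linear_bary_hom] bary_hom_scale)
qed

lemma extend_affine_bary:
  assumes "affine_map f" "hom (f A) = bary_hom a" "hom (f B) = bary_hom b" "hom (f C) = bary_hom c" "u \<noteq> 0"
  shows "extend_affine f (bary u) = bary (u$1 *\<^sub>R a + u$2 *\<^sub>R b + u$3 *\<^sub>R c)"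
  using assms by (simp add: bary_def extend_affine_abs bary_hom_eq_0_iff hom_map_bary_hom)

lemma affine_map_eqI:
  assumes "affine_map f" "affine_map g" "f A = g A" "f B = g B" "f C = g C"
  shows "f = g"
proof
  fix x
  obtain u where u: "hom x = bary_hom u" using surj_bary_hom by (metis surjD)
  have "hom_map f (bary_hom u) = hom_map g (bary_hom u)"
    unfolding bary_hom_def[of u] linear_add[OF linear_hom_map[OF assms(1)]]
      linear_scale[OF linear_hom_map[OF assms(1)]]
      linear_add[OF linear_hom_map[OF assms(2)]]
      linear_scale[OF linear_hom_map[OF assms(2)]]
      hom_map_hom by (simp add: assms)
  then show "f x = g x" by (simp add: u[symmetric] hom_map_hom hom_inj)
qed

lemma affine_map_exists: "\<exists>f. affine_map f \<and> f A = D \<and> f B = E \<and> f C = F"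
proof -
  obtain g where g: "linear g" "\<And>u. g (bary_hom u) = u"
    using linear_injective_isomorphism[OF linear_bary_hom inj_bary_hom] by blast
  define f where "f x = g (hom x) $ 1 *\<^sub>R D + g (hom x) $ 2 *\<^sub>R E + g (hom x) $ 3 *\<^sub>R F" for x
  have v: "hom A = bary_hom (vector [1, 0, 0])" "hom B = bary_hom (vector [0, 1, 0])" "hom C = bary_hom (vector [0, 0, 1])"
    by (simp_all add: bary_hom_def)
  have "f A = D" "f B = E" "f C = F"
    by (simp_all add: f_def v g)
  moreover have "affine_map f"
  proof -
    define k where "k x = g (hom x - hom 0)" for x
    have k: "k (x + y) = k x + k y" "k (r *\<^sub>R x) = r *\<^sub>R k x" for x y r
    proof -
      have "hom (x + y) - hom 0 = (hom x - hom 0) + (hom y - hom 0)"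
        "hom (r *\<^sub>R x) - hom 0 = r *\<^sub>R (hom x - hom 0)"
        by (simp_all add: hom_def coords algebra_simps)
      then show "k (x + y) = k x + k y" "k (r *\<^sub>R x) = r *\<^sub>R k x"
        by (simp_all only: k_def linear_add[OF g(1)] linear_scale[OF g(1)])
    qed
    have "(\<lambda>x. f x - f 0) = (\<lambda>x. k x $ 1 *\<^sub>R D + k x $ 2 *\<^sub>R E + k x $ 3 *\<^sub>R F)"
      unfolding f_def k_def by (simp add: linear_diff[OF g(1)] algebra_simps)
    moreover have "linear \<dots>"
      by (intro linearI) (simp_all add: k algebra_simps)
    ultimately show ?thesis unfolding affine_map_def by simp
  qed
  ultimately show ?thesis by blast
qed

text \<open>Coordinate vectors of sum 1 represent their points exactly, not just up to a factor. This is why the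
images of the vertices are normalized here: the three scales determine the linear map.\<close>

lemma affine_to_bary:
  assumes "a$1 + a$2 + a$3 = 1" "b$1 + b$2 + b$3 = 1" "c$1 + c$2 + c$3 = 1"
  defines "f \<equiv> affine_to A B C (bary a) (bary b) (bary c)"
  shows "affine_map f" "hom (f A) = bary_hom a" "hom (f B) = bary_hom b" "hom (f C) = bary_hom c"
proof -
  let ?pt = "\<lambda>u. u$1 *\<^sub>R A + u$2 *\<^sub>R B + u$3 *\<^sub>R C"
  obtain g where g: "affine_map g" "g A = ?pt a" "g B = ?pt b" "g C = ?pt c"
    using affine_map_exists by blast
  have "f = g"
    unfolding f_def affine_to_def
  proof (rule the_equality)
    show "affine_map g \<and> pt (g A) = bary a \<and> pt (g B) = bary b \<and> pt (g C) = bary c"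
      using g assms by (simp add: bary_eq_pt)
  next
    fix h assume "affine_map h \<and> pt (h A) = bary a \<and> pt (h B) = bary b \<and> pt (h C) = bary c"
    then have "affine_map h" "h A = ?pt a" "h B = ?pt b" "h C = ?pt c"
      using assms by (auto simp: bary_eq_pt pt_eq_iff)
    then show "h = g" using g affine_map_eqI by simp
  qed
  with g assms show "affine_map f" "hom (f A) = bary_hom a" "hom (f B) = bary_hom b" "hom (f C) = bary_hom c"
    by (simp_all add: bary_hom_eq_hom)
qed

end

section \<open>Circumconics\<close>

text \<open>In barycentric coordinates this is isotomic conjugation, and it is also the vector of monomials
\<open>yz\<close>, \<open>zx\<close>, \<open>xy\<close> of a conic through the vertices. Such a conic is therefore the isotomic image of a
line.\<close>

definition pair_prods :: "real^3 \<Rightarrow> real^3" where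
  "pair_prods u = vector [u$2 * u$3, u$3 * u$1, u$1 * u$2]"

text \<open>The symmetric matrix of the form \<open>2 (k\<^sub>1 yz + k\<^sub>2 zx + k\<^sub>3 xy)\<close> applied to \<open>u\<close>: the coefficient vector of
the polar of \<open>u\<close>.\<close>

definition polarity :: "real^3 \<Rightarrow> real^3 \<Rightarrow> real^3" where
  "polarity k u = vector [k$3 * u$2 + k$2 * u$3, k$1 * u$3 + k$3 * u$1, k$2 * u$1 + k$1 * u$2]"

lemma linear_polarity: "linear (polarity k)"
  by (rule linearI) (simp_all add: polarity_def coords algebra_simps)

lemma polarity_sym: "u \<bullet> polarity k v = v \<bullet> polarity k u"
  by (simp add: polarity_def coords algebra_simps)

lemma polarity_self: "u \<bullet> polarity k u = 2 * (k \<bullet> pair_prods u)"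
  by (simp add: polarity_def pair_prods_def coords algebra_simps)

lemma polarity_scale_left: "polarity (c *\<^sub>R k) u = c *\<^sub>R polarity k u"
  by (simp add: polarity_def coords algebra_simps)

lemma polarity_eq_0_iff:
  assumes "k$1 \<noteq> 0" "k$2 \<noteq> 0" "k$3 \<noteq> 0"
  shows "polarity k u = 0 \<longleftrightarrow> u = 0"
proof
  assume "polarity k u = 0"
  then have e: "k$3 * u$2 + k$2 * u$3 = 0" "k$1 * u$3 + k$3 * u$1 = 0" "k$2 * u$1 + k$1 * u$2 = 0"
    by (simp_all add: polarity_def coords)
  have "2 * k$2 * k$3 * u$1 = 0" "2 * k$3 * k$1 * u$2 = 0" "2 * k$1 * k$2 * u$3 = 0"
    using e by algebra+
  with assms show "u = 0" by (simp add: coords)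
qed (simp add: polarity_def coords)

context triangle
begin

definition circumconic :: "real^3 \<Rightarrow> epoint set" where
  "circumconic k = {bary u | u. u \<noteq> 0 \<and> k \<bullet> pair_prods u = 0}"

lemma conic_matrix_bary:
  assumes "conic_matrix M c" "u \<noteq> 0"
  shows "bary u \<in> c \<longleftrightarrow> bary_hom u \<bullet> (M *v bary_hom u) = 0"
proof -
  obtain t where "t \<noteq> 0" "rep_epoint (bary u) = t *\<^sub>R bary_hom u" using rep_bary[OF assms(2)] .
  with assms show ?thesis by (simp add: conic_matrix_def matrix_vector_mult_scaleR)
qed

lemma bary_in_circumconic_iff:
  assumes "u \<noteq> 0"
  shows "bary u \<in> circumconic k \<longleftrightarrow> k \<bullet> pair_prods u = 0"
proof
  assume "bary u \<in> circumconic k"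
  then obtain v where v: "bary u = bary v" "v \<noteq> 0" "k \<bullet> pair_prods v = 0" by (auto simp: circumconic_def)
  then obtain c where "u = c *\<^sub>R v"
    using assms bary_eq_iff[of v u] cross_eq_0_iff_scaleR[of v u] by auto
  then have "pair_prods u = (c * c) *\<^sub>R pair_prods v" by (simp add: pair_prods_def coords)
  with v show "k \<bullet> pair_prods u = 0" by simp
qed (use assms in \<open>auto simp: circumconic_def\<close>)

text \<open>Membership of the three vertices makes the diagonal of the matrix vanish in the barycentric frame, so
three coefficients remain.\<close>

lemma conic_through_vertices:
  assumes "conic_matrix M c" "pt A \<in> c" "pt B \<in> c" "pt C \<in> c"
  obtains k where "k \<noteq> 0" "\<And>u v. bary_hom u \<bullet> (M *v bary_hom v) = u \<bullet> polarity k v"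
    "c = circumconic k"
proof -
  have sym: "x \<bullet> (M *v y) = y \<bullet> (M *v x)" for x y
    using assms(1) dot_lmul_matrix[of x M y] transpose_matrix_vector[of M x]
    by (simp add: conic_matrix_def inner_commute)
  define k :: "real^3" where "k = vector [hom B \<bullet> (M *v hom C), hom C \<bullet> (M *v hom A), hom A \<bullet> (M *v hom B)]"
  have diag: "hom A \<bullet> (M *v hom A) = 0" "hom B \<bullet> (M *v hom B) = 0" "hom C \<bullet> (M *v hom C) = 0"
  proof -
    have v: "hom A = bary_hom (vector [1, 0, 0])" "hom B = bary_hom (vector [0, 1, 0])" "hom C = bary_hom (vector [0, 0, 1])"
      by (simp_all add: bary_hom_def)
    show "hom A \<bullet> (M *v hom A) = 0" "hom B \<bullet> (M *v hom B) = 0" "hom C \<bullet> (M *v hom C) = 0"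
      unfolding v using assms
      by (simp_all add: conic_matrix_bary[OF assms(1), symmetric] vertices_bary vec3_eq_iff)
  qed
  have form: "bary_hom u \<bullet> (M *v bary_hom v) = u \<bullet> polarity k v" for u v
    unfolding bary_hom_def
    by (simp add: matrix_vector_right_distrib matrix_vector_mult_scaleR inner_add_left inner_add_right diag
        sym[of "hom B" "hom A"] sym[of "hom C" "hom B"] sym[of "hom A" "hom C"])
       (simp add: k_def polarity_def coords algebra_simps)
  have "k \<noteq> 0"
  proof
    assume "k = 0"
    then have "polarity k v = 0" for v by (simp add: polarity_def vec3_eq_iff)
    then have z: "bary_hom u \<bullet> (M *v bary_hom v) = 0" for u v by (simp add: form)
    have "M *v y = 0" for y
    proof -
      obtain u v where "M *v y = bary_hom u" "y = bary_hom v" using surj_bary_hom by (metis surjD)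
      with z[of u v] show ?thesis by simp
    qed
    moreover obtain N where "N ** M = mat 1"
      using assms(1) by (auto simp: conic_matrix_def invertible_def)
    ultimately have "y = 0" for y :: "real^3"
      by (metis matrix_vector_mul_assoc matrix_vector_mul_lid matrix_vector_mult_0_right)
    then show False using rep_epoint_nonzero by blast
  qed
  moreover have "bary u \<in> c \<longleftrightarrow> bary u \<in> circumconic k" if "u \<noteq> 0" for u
    using that by (simp add: conic_matrix_bary[OF assms(1)] bary_in_circumconic_iff form polarity_self)
  then have "c = circumconic k" by (metis bary_cases set_eqI)
  ultimately show ?thesis using that form by blast
qed

text \<open>The matrix has to be given in the standard frame, so the matrix of the form is conjugated with the
inverse of the coordinate change.\<close>

lemma circumconic_has_matrix:
  assumes "k$1 \<noteq> 0" "k$2 \<noteq> 0" "k$3 \<noteq> 0"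
  shows "\<exists>M. conic_matrix M (circumconic k)"
proof -
  obtain g where g: "linear g" "\<And>u. g (bary_hom u) = u"
    using linear_injective_isomorphism[OF linear_bary_hom inj_bary_hom] by blast
  define G where "G = matrix g"
  have G: "G *v bary_hom u = u" for u by (simp add: G_def matrix_works linear_matrix_vector_mul_eq g)
  define N :: "real^3^3" where "N = vector [vector [0, k$3, k$2], vector [k$3, 0, k$1], vector [k$2, k$1, 0]]"
  have N: "N *v u = polarity k u" for u
    by (simp add: N_def polarity_def vec3_eq_iff matrix_vector_mult_def sum_3)
  have "transpose N = N" by (simp add: transpose_def N_def vec_eq_iff forall_3)
  define M where "M = transpose G ** N ** G"
  have form: "bary_hom u \<bullet> (M *v bary_hom v) = u \<bullet> polarity k v" for u v
  proof -
    have "bary_hom u \<bullet> (M *v bary_hom v) = bary_hom u \<bullet> (transpose G *v (N *v (G *v bary_hom v)))"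
      by (simp add: M_def matrix_vector_mul_assoc matrix_mul_assoc)
    also have "\<dots> = (G *v bary_hom u) \<bullet> (N *v (G *v bary_hom v))"
      using dot_lmul_matrix[of "bary_hom u" "transpose G"] transpose_matrix_vector[of "transpose G" "bary_hom u"]
      by (simp add: transpose_transpose)
    finally show ?thesis by (simp add: G N)
  qed
  have "transpose M = M"
    unfolding M_def
    by (simp add: matrix_transpose_mul transpose_transpose \<open>transpose N = N\<close> matrix_mul_assoc)
  moreover have "invertible M"
  proof -
    have "y = 0" if "M *v y = 0" for y
    proof -
      obtain v where v: "y = bary_hom v" using surj_bary_hom by (metis surjD)
      have "polarity k v \<bullet> polarity k v = 0" using form[of "polarity k v" v] that v by simp
      then have "v = 0" using assms by (simp add: polarity_eq_0_iff)
      then show ?thesis by (simp add: v bary_hom_eq_0_iff)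
    qed
    then show ?thesis
      unfolding invertible_left_inverse matrix_left_invertible_ker by blast
  qed
  moreover have "circumconic k = {X. rep_epoint X \<bullet> (M *v rep_epoint X) = 0}" (is "_ = ?c")
  proof -
    have "bary u \<in> circumconic k \<longleftrightarrow> bary u \<in> ?c" if u: "u \<noteq> 0" for u
    proof -
      obtain t where "t \<noteq> 0" "rep_epoint (bary u) = t *\<^sub>R bary_hom u" using rep_bary[OF u] .
      then show ?thesis
        by (simp add: matrix_vector_mult_scaleR form polarity_self bary_in_circumconic_iff[OF u])
    qed
    then show ?thesis by (metis bary_cases set_eqI)
  qed
  ultimately show ?thesis unfolding conic_matrix_def by blast
qed

end

text \<open>A conic through the vertices, \<open>p\<close> and \<open>q\<close> has its coefficient vector orthogonal to \<open>pair_prods p\<close> and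
\<open>pair_prods q\<close>, so that vector is their cross product up to a factor. The determinant of the conic is
\<open>2 k\<^sub>1 k\<^sub>2 k\<^sub>3\<close>, so it is nondegenerate when no coefficient vanishes.\<close>

locale five_points = triangle +
  fixes p q k :: "real^3"
  assumes k_eq: "k = pair_prods p \<times> pair_prods q"
    and k_nonzero: "k$1 \<noteq> 0" "k$2 \<noteq> 0" "k$3 \<noteq> 0"
begin

lemma pq_nonzero: "p \<noteq> 0" "q \<noteq> 0"
  using k_nonzero by (auto simp: k_eq pair_prods_def coords)

lemma five_points_in_circumconic: "{pt A, pt B, pt C, bary p, bary q} \<subseteq> circumconic k"
proof -
  have "k \<bullet> pair_prods p = 0" "k \<bullet> pair_prods q = 0" by (simp_all add: k_eq dot_cross_self)
  then show ?thesis
    using pq_nonzero by (simp add: vertices_bary bary_in_circumconic_iff coords)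
      (simp add: pair_prods_def)
qed

text \<open>Five points determine the matrix, not only the conic, up to a factor. This makes the polar, which
refers to all matrices of the conic, independent of the matrix.\<close>

lemma conic_matrix_five_points:
  assumes "conic_matrix M c" "{pt A, pt B, pt C, bary p, bary q} \<subseteq> c"
  shows "c = circumconic k \<and> (\<exists>t. t \<noteq> 0 \<and> (\<forall>u v. bary_hom u \<bullet> (M *v bary_hom v) = t * (u \<bullet> polarity k v)))"
proof -
  obtain m where m: "m \<noteq> 0" "\<And>u v. bary_hom u \<bullet> (M *v bary_hom v) = u \<bullet> polarity m v" "c = circumconic m"
    using conic_through_vertices[OF assms(1)] assms(2) by blast
  have "m \<bullet> pair_prods p = 0" "m \<bullet> pair_prods q = 0"
    using assms(2) pq_nonzero by (simp_all add: m(3) bary_in_circumconic_iff)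
  moreover have "pair_prods p \<times> pair_prods q \<noteq> 0" using k_nonzero by (auto simp: k_eq[symmetric])
  ultimately obtain t where t: "m = t *\<^sub>R k"
    using orthogonal_pair_imp_cross[of "pair_prods p" "pair_prods q" m] k_eq by auto
  with m(1) have "t \<noteq> 0" by auto
  moreover have "c = circumconic k" using \<open>t \<noteq> 0\<close> by (simp add: m(3) t circumconic_def)
  ultimately show ?thesis using m(2) by (auto simp: t polarity_scale_left)
qed

lemma nondeg_circumconic: "nondeg_conic (circumconic k)"
  unfolding nondeg_conic_def
  using circumconic_has_matrix[OF k_nonzero] five_points_in_circumconic by auto

lemma conic_through_five_points: "conic_through {pt A, pt B, pt C, bary p, bary q} = circumconic k"
  unfolding conic_through_def
proof (rule the_equality)
  show "nondeg_conic (circumconic k) \<and> {pt A, pt B, pt C, bary p, bary q} \<subseteq> circumconic k"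
    using nondeg_circumconic five_points_in_circumconic by blast
next
  fix c assume "nondeg_conic c \<and> {pt A, pt B, pt C, bary p, bary q} \<subseteq> c"
  then show "c = circumconic k"
    using conic_matrix_five_points unfolding nondeg_conic_def by blast
qed

lemma polar_circumconic:
  assumes u: "u \<noteq> 0"
  shows "polar (circumconic k) (bary u) = bline (polarity k u)"
proof -
  obtain M where M: "conic_matrix M (circumconic k)"
    using circumconic_has_matrix[OF k_nonzero] by blast
  have form: "\<exists>t. t \<noteq> 0 \<and> (\<forall>u v. bary_hom u \<bullet> (N *v bary_hom v) = t * (u \<bullet> polarity k v))"
    if "conic_matrix N (circumconic k)" for N
    using conic_matrix_five_points[OF that five_points_in_circumconic] by blast
  obtain a where a: "a \<noteq> 0" "rep_epoint (bary u) = a *\<^sub>R bary_hom u" using rep_bary[OF u] .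
  have "bary v \<in> polar (circumconic k) (bary u) \<longleftrightarrow> bary v \<in> bline (polarity k u)" if v: "v \<noteq> 0" for v
  proof -
    obtain b where b: "b \<noteq> 0" "rep_epoint (bary v) = b *\<^sub>R bary_hom v" using rep_bary[OF v] .
    have "rep_epoint (bary u) \<bullet> (N *v rep_epoint (bary v)) = 0 \<longleftrightarrow> u \<bullet> polarity k v = 0"
      if "conic_matrix N (circumconic k)" for N
      using form[OF that] a(1) b(1) by (auto simp: a(2) b(2) matrix_vector_mult_scaleR)
    then have "bary v \<in> polar (circumconic k) (bary u) \<longleftrightarrow> u \<bullet> polarity k v = 0"
      using M unfolding polar_def by blast
    also have "\<dots> \<longleftrightarrow> bary v \<in> bline (polarity k u)"
      by (simp add: bary_in_bline_iff[OF v] polarity_sym[of u] inner_commute)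
    finally show ?thesis .
  qed
  then show ?thesis by (metis bary_cases set_eqI)
qed

lemma polarity_inj:
  assumes "u \<noteq> 0" "v \<noteq> 0" "polarity k u \<times> polarity k v = 0"
  shows "bary u = bary v"
proof -
  obtain c where c: "polarity k v = c *\<^sub>R polarity k u"
    using assms cross_eq_0_iff_scaleR polarity_eq_0_iff[OF k_nonzero] by metis
  have "polarity k (v - c *\<^sub>R u) = 0"
    by (simp add: c linear_diff[OF linear_polarity] linear_scale[OF linear_polarity])
  then have "v = c *\<^sub>R u" using polarity_eq_0_iff[OF k_nonzero] by simp
  with assms show ?thesis by (metis bary_scale scaleR_zero_left)
qed

text \<open>The vector \<open>(1, 1, 1)\<close> holds the coefficients of the line at infinity, so \<open>z\<close> is its pole; the pole is
unique because the polarity is injective.\<close>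

lemma conic_center_circumconic:
  assumes z: "z \<noteq> 0" and par: "polarity k z \<times> vector [1, 1, 1] = 0"
  shows "conic_center (circumconic k) = bary z"
  unfolding conic_center_def pole_def
proof (rule the_equality)
  have one: "vector [1, 1, 1] \<noteq> (0 :: real^3)" by (simp add: coords)
  have polz: "bline (polarity k z) = line_inf"
    unfolding line_inf_eq using par z one by (simp add: bline_eq_iff polarity_eq_0_iff[OF k_nonzero])
  then show "polar (circumconic k) (bary z) = line_inf" by (simp add: polar_circumconic z)
  fix X assume X: "polar (circumconic k) X = line_inf"
  obtain u where u: "u \<noteq> 0" "X = bary u" by (rule bary_cases)
  then have "polarity k u \<times> polarity k z = 0"
    using X polz z by (simp add: polar_circumconic bline_eq_iff[symmetric] polarity_eq_0_iff[OF k_nonzero])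
  then show "X = bary z" using polarity_inj[of u z] u z by simp
qed

text \<open>If the tangent at \<open>u\<close> contained a second point \<open>v\<close> of the conic, both polars would be the line \<open>uv\<close>,
against injectivity of the polarity.\<close>

lemma tangent_meets_once:
  assumes u: "u \<noteq> 0" "bary u \<in> circumconic k" and v: "v \<noteq> 0" "bary v \<in> circumconic k"
    and tangent: "bary v \<in> bline (polarity k u)"
  shows "bary u = bary v"
proof (rule ccontr)
  assume "bary u \<noteq> bary v"
  then have uv: "u \<times> v \<noteq> 0" using u v by (simp add: bary_eq_iff)
  have self: "polarity k u \<bullet> u = 0" "polarity k v \<bullet> v = 0"
    using u v by (simp_all add: bary_in_circumconic_iff polarity_self inner_commute)
  have cross: "polarity k u \<bullet> v = 0" "polarity k v \<bullet> u = 0"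
    using tangent v polarity_sym[of u k v] by (simp_all add: bary_in_bline_iff inner_commute)
  obtain a b where "polarity k u = a *\<^sub>R (u \<times> v)" "polarity k v = b *\<^sub>R (u \<times> v)"
    using orthogonal_pair_imp_cross[OF uv] self cross by metis
  then have "polarity k u \<times> polarity k v = 0" by (simp add: cross_mult_left cross_mult_right)
  then show False using polarity_inj u v \<open>bary u \<noteq> bary v\<close> by blast
qed

text \<open>A line through a point of the conic that is not the tangent there contains a point \<open>w\<close> not conjugate
to \<open>u\<close>; on the pencil spanned by \<open>u\<close> and \<open>w\<close> the quadratic equation of the conic has the root \<open>u\<close> and
a second root different from it.\<close>

lemma secant_second_point:
  assumes u: "u \<noteq> 0" "bary u \<in> circumconic k" "n \<bullet> u = 0" and n: "polarity k u \<times> n \<noteq> 0"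
  obtains v where "v \<noteq> 0" "bary v \<in> circumconic k" "n \<bullet> v = 0" "bary v \<noteq> bary u"
proof -
  define w where "w = (polarity k u \<times> n) \<times> n"
  define t where "t = w \<bullet> polarity k u"
  have "t = - ((polarity k u \<times> n) \<bullet> (polarity k u \<times> n))"
    by (simp add: t_def w_def coords) algebra
  with n have t: "t \<noteq> 0" by simp
  have nw: "n \<bullet> w = 0" by (simp add: w_def dot_cross_self)
  have uu: "u \<bullet> polarity k u = 0" using u by (simp add: bary_in_circumconic_iff polarity_self)
  \<comment> \<open>The form at \<open>a w + b u\<close> is \<open>a (a (w \<bullet> S w) + 2 b t)\<close> with \<open>S\<close> the polarity, which vanishes at
    \<open>a = 2 t\<close> and \<open>b = - (w \<bullet> S w)\<close>.\<close>
  define v where "v = (2 * t) *\<^sub>R w - (w \<bullet> polarity k w) *\<^sub>R u"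
  have vu: "v \<bullet> polarity k u = 2 * t * t" by (simp add: v_def inner_diff_left uu t_def)
  have "v \<noteq> 0" using vu t by auto
  have "v \<bullet> polarity k v = 0"
    using polarity_sym[of u k w] by (simp add: v_def linear_diff[OF linear_polarity] linear_scale[OF linear_polarity]
        inner_diff_left inner_diff_right uu t_def[symmetric])
  then have "bary v \<in> circumconic k" using \<open>v \<noteq> 0\<close> by (simp add: bary_in_circumconic_iff polarity_self)
  moreover have "n \<bullet> v = 0" using u nw by (simp add: v_def inner_diff_right)
  moreover have "bary v \<noteq> bary u"
  proof
    assume "bary v = bary u"
    then obtain c where "v = c *\<^sub>R u"
      using u \<open>v \<noteq> 0\<close> bary_eq_iff[of u v] cross_eq_0_iff_scaleR[of u v] by auto
    then show False using vu t uu by simp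
  qed
  ultimately show ?thesis using that \<open>v \<noteq> 0\<close> by blast
qed

text \<open>Since the line at infinity has one point in common with the conic, it is the tangent there, so this
point is its pole.\<close>

lemma parabola_center:
  assumes "is_parabola (circumconic k)"
  shows "circumconic k \<inter> line_inf = {conic_center (circumconic k)}"
proof -
  obtain X where X: "circumconic k \<inter> line_inf = {X}"
    using assms by (auto simp: is_parabola_def card_1_singleton_iff)
  obtain u where u: "u \<noteq> 0" "X = bary u" by (rule bary_cases)
  have "polarity k u \<times> vector [1, 1, 1] = 0"
  proof (rule ccontr)
    assume "polarity k u \<times> vector [1, 1, 1] \<noteq> 0"
    moreover have "bary u \<in> circumconic k" "bary u \<in> line_inf" using X u by auto
    ultimately obtain v where "v \<noteq> 0" "bary v \<in> circumconic k" "vector [1, 1, 1] \<bullet> v = 0" "bary v \<noteq> bary u"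
      using secant_second_point[of u "vector [1, 1, 1]"] u(1) by (auto simp: line_inf_eq bary_in_bline_iff)
    then have "bary v \<in> circumconic k \<inter> line_inf" by (simp add: line_inf_eq bary_in_bline_iff)
    then show False using X u \<open>bary v \<noteq> bary u\<close> by auto
  qed
  then show ?thesis using conic_center_circumconic[OF u(1)] X u by simp
qed

text \<open>The tangent at an infinite point of a hyperbola is not the line at infinity, which contains two
points of the conic, so it is an asymptote, and its only infinite point is the point of contact.\<close>

lemma hyperbola_asymptotes:
  assumes "is_hyperbola (circumconic k)"
  shows "{X \<in> line_inf. \<exists>l. asymptote (circumconic k) l \<and> X \<in> l} = circumconic k \<inter> line_inf"
proof -
  have tangent: "polar (circumconic k) X \<noteq> line_inf \<and> (\<forall>W \<in> line_inf. W \<in> polar (circumconic k) X \<longleftrightarrow> W = X)"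
    if X: "X \<in> circumconic k \<inter> line_inf" for X
  proof -
    obtain u where u: "u \<noteq> 0" "X = bary u" by (rule bary_cases)
    have pol: "polar (circumconic k) X = bline (polarity k u)" using u by (simp add: polar_circumconic)
    have "X \<in> polar (circumconic k) X"
      unfolding pol using X u
      by (simp add: bary_in_bline_iff bary_in_circumconic_iff polarity_self inner_commute[of "polarity k u"])
    have "card (circumconic k \<inter> line_inf) = 2" using assms by (simp add: is_hyperbola_def)
    then obtain a b where "circumconic k \<inter> line_inf = {a, b}" "a \<noteq> b" unfolding card_2_iff by blast
    with X obtain Y where Y: "Y \<in> circumconic k" "Y \<in> line_inf" "Y \<noteq> X" by blast
    obtain v where v: "v \<noteq> 0" "Y = bary v" by (rule bary_cases)
    have neq: "bline (polarity k u) \<noteq> line_inf"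
    proof
      assume "bline (polarity k u) = line_inf"
      then have "bary u = bary v"
        using X Y tangent_meets_once[OF u(1) _ v(1)] unfolding u(2) v(2) by blast
      then show False using Y(3) u(2) v(2) by simp
    qed
    have "polarity k u \<noteq> 0" "vector [1, 1, 1] \<noteq> (0 :: real^3)"
      using u polarity_eq_0_iff[OF k_nonzero] by (simp_all add: vec3_eq_iff)
    with neq have "polarity k u \<times> vector [1, 1, 1] \<noteq> 0"
      unfolding line_inf_eq by (simp add: bline_eq_iff)
    then have "bline (polarity k u) \<inter> line_inf = {bary (polarity k u \<times> vector [1, 1, 1])}"
      unfolding line_inf_eq by (rule bline_Int)
    moreover have "X \<in> bline (polarity k u) \<inter> line_inf"
      using \<open>X \<in> polar (circumconic k) X\<close> X by (simp add: pol)
    ultimately have "bline (polarity k u) \<inter> line_inf = {X}" by simp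
    then have "W \<in> bline (polarity k u) \<longleftrightarrow> W = X" if "W \<in> line_inf" for W
      using that by (metis IntD1 IntI singleton_iff)
    with neq show ?thesis by (simp add: pol)
  qed
  show ?thesis
  proof (intro set_eqI iffI)
    fix X assume X: "X \<in> {X \<in> line_inf. \<exists>l. asymptote (circumconic k) l \<and> X \<in> l}"
    then obtain Y where "Y \<in> circumconic k \<inter> line_inf" "X \<in> polar (circumconic k) Y" "X \<in> line_inf"
      by (auto simp: asymptote_def)
    then show "X \<in> circumconic k \<inter> line_inf" using tangent[of Y] by metis
  next
    fix X assume X: "X \<in> circumconic k \<inter> line_inf"
    have "asymptote (circumconic k) (polar (circumconic k) X)" "X \<in> polar (circumconic k) X" "X \<in> line_inf"
      using tangent[OF X] X unfolding asymptote_def by blast+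
    then show "X \<in> {X \<in> line_inf. \<exists>l. asymptote (circumconic k) l \<and> X \<in> l}" by blast
  qed
qed

end

section \<open>The identities for the cevian configuration\<close>

text \<open>The hypotheses on \<open>P = (p : q : r)\<close> in coordinates: \<open>P\<close> is ordinary, lies on no side of \<open>ABC\<close> or of
the anticomplementary triangle and on no median, and \<open>P'\<close> is ordinary.\<close>

locale cevian = triangle +
  fixes p q r :: real
  assumes sum1: "p + q + r = 1"
    and off_sides: "p \<noteq> 0" "q \<noteq> 0" "r \<noteq> 0"
    and off_anti: "q + r \<noteq> 0" "r + p \<noteq> 0" "p + q \<noteq> 0"
    and off_medians: "p \<noteq> q" "q \<noteq> r" "r \<noteq> p"
    and iso_ordinary: "q * r + r * p + p * q \<noteq> 0"
begin

text \<open>Coordinate vectors of the points \<open>P\<close>, \<open>P'\<close>, \<open>Q\<close>, \<open>Q'\<close>, \<open>V\<close>, \<open>Z\<close> and of the lines \<open>GV\<close> and \<open>T\<^sub>P(GV)\<close>.\<close>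

definition "uP = (vector [p, q, r] :: real^3)"
definition "uP' = (vector [q * r, r * p, p * q] :: real^3)"
definition "uQ = (vector [p * (q + r), q * (r + p), r * (p + q)] :: real^3)"
definition "uQ' = (vector [q + r, r + p, p + q] :: real^3)"
definition "uV = (vector [p * (q\<^sup>2 + q * r + r\<^sup>2), q * (r\<^sup>2 + r * p + p\<^sup>2), r * (p\<^sup>2 + p * q + q\<^sup>2)] :: real^3)"
definition "uZ = (vector [p * (q - r)\<^sup>2, q * (r - p)\<^sup>2, r * (p - q)\<^sup>2] :: real^3)"
definition "lGV = (vector [(q - r) * (p\<^sup>2 - q * r), (r - p) * (q\<^sup>2 - r * p), (p - q) * (r\<^sup>2 - p * q)] :: real^3)"
definition "lTGV = (vector
  [q * r * (- (q\<^sup>2 - r\<^sup>2) * (p\<^sup>2 - q * r) + (r\<^sup>2 - p\<^sup>2) * (q\<^sup>2 - r * p) + (p\<^sup>2 - q\<^sup>2) * (r\<^sup>2 - p * q)),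
   r * p * ((q\<^sup>2 - r\<^sup>2) * (p\<^sup>2 - q * r) - (r\<^sup>2 - p\<^sup>2) * (q\<^sup>2 - r * p) + (p\<^sup>2 - q\<^sup>2) * (r\<^sup>2 - p * q)),
   p * q * ((q\<^sup>2 - r\<^sup>2) * (p\<^sup>2 - q * r) + (r\<^sup>2 - p\<^sup>2) * (q\<^sup>2 - r * p) - (p\<^sup>2 - q\<^sup>2) * (r\<^sup>2 - p * q))] :: real^3)"

definition discr :: real where "discr = (p - q) * (q - r) * (r - p)"

lemma discr_nonzero: "discr \<noteq> 0"
  using off_medians by (simp add: discr_def)

lemma vectors_nonzero: "uP \<noteq> 0" "uP' \<noteq> 0" "uQ \<noteq> 0" "uQ' \<noteq> 0" "uZ \<noteq> 0"
  using off_sides off_anti off_medians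
  by (simp_all add: uP_def uP'_def uQ_def uQ'_def uZ_def vec3_eq_iff)

definition conic_coeffs :: "real^3" where "conic_coeffs = pair_prods uP \<times> pair_prods uQ"

lemma conic_coeffs_eq: "conic_coeffs = (- (p * q * r)) *\<^sub>R
    vector [p * (q + r) * (q - r), q * (r + p) * (r - p), r * (p + q) * (p - q)]"
  by (simp add: conic_coeffs_def pair_prods_def uP_def uQ_def coords) algebra

sublocale five_points A B C uP uQ conic_coeffs
proof
  show "conic_coeffs = pair_prods uP \<times> pair_prods uQ" by (rule conic_coeffs_def)
  show "conic_coeffs $ 1 \<noteq> 0" "conic_coeffs $ 2 \<noteq> 0" "conic_coeffs $ 3 \<noteq> 0"
    using off_sides off_anti off_medians by (simp_all add: conic_coeffs_eq)
qed

lemma center: "conic_center (circumconic conic_coeffs) = bary uZ"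
proof (rule conic_center_circumconic)
  have "polarity conic_coeffs uZ = (2 * (p * q * r)\<^sup>2 * discr) *\<^sub>R vector [1, 1, 1]"
    by (simp add: conic_coeffs_eq polarity_def uZ_def discr_def vec3_eq_iff) algebra
  then show "polarity conic_coeffs uZ \<times> vector [1, 1, 1] = 0" by (simp add: cross_mult_left)
qed (rule vectors_nonzero)

text \<open>This identity contains both claims about \<open>Z\<close>: the lines differ because the factor is nonzero, and they
meet in \<open>Z\<close>.\<close>

lemma lGV_cross_lTGV: "lGV \<times> lTGV = (discr * (q * r + r * p + p * q) * (p + q + r)) *\<^sub>R uZ"
  by (simp add: lGV_def lTGV_def uZ_def discr_def coords) algebra

lemma lGV_cross_lTGV_nonzero: "lGV \<times> lTGV \<noteq> 0"
  unfolding lGV_cross_lTGV using discr_nonzero iso_ordinary sum1 vectors_nonzero by simp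

lemma meet_GV_TGV: "meet (bline lGV) (bline lTGV) = bary uZ"
  unfolding meet_bline[OF lGV_cross_lTGV_nonzero] unfolding lGV_cross_lTGV
  using discr_nonzero iso_ordinary sum1 by (intro bary_scale) simp

lemma meet_PQ_P'Q': "meet (join (bary uP) (bary uQ)) (join (bary uP') (bary uQ')) = bary uV"
  and uV_nonzero: "uV \<noteq> 0"
proof -
  \<comment> \<open>The form \<open>q\<^sup>2 + q r + r\<^sup>2\<close> is positive definite.\<close>
  have "q\<^sup>2 + q * r + r\<^sup>2 = (q + r / 2)\<^sup>2 + 3 / 4 * r\<^sup>2" by (simp add: power2_eq_square algebra_simps)
  then have "q\<^sup>2 + q * r + r\<^sup>2 > 0" using off_sides by (simp add: add_nonneg_pos)
  then show uV: "uV \<noteq> 0" using off_sides by (simp add: uV_def vec3_eq_iff)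
  have "(uP \<times> uQ) \<times> (uP' \<times> uQ') = discr *\<^sub>R uV"
    by (simp add: uP_def uQ_def uP'_def uQ'_def uV_def discr_def coords) algebra
  moreover from this uV discr_nonzero have "(uP \<times> uQ) \<times> (uP' \<times> uQ') \<noteq> 0" by simp
  moreover from this have "uP \<times> uQ \<noteq> 0" "uP' \<times> uQ' \<noteq> 0" by auto
  ultimately show "meet (join (bary uP) (bary uQ)) (join (bary uP') (bary uQ')) = bary uV"
    using discr_nonzero by (simp add: join_bary meet_bline bary_scale)
qed

lemma join_GV: "join (bary (vector [1, 1, 1])) (bary uV) = bline lGV"
proof -
  have e: "vector [1, 1, 1] \<times> uV = (-1) *\<^sub>R lGV"
    by (simp add: uV_def lGV_def coords) algebra
  have "lGV \<noteq> 0" using lGV_cross_lTGV_nonzero by auto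
  then have "vector [1, 1, 1] \<times> uV \<noteq> 0" by (simp add: e)
  then have "join (bary (vector [1, 1, 1])) (bary uV) = bline ((-1) *\<^sub>R lGV)"
    unfolding e[symmetric] by (rule join_bary)
  also have "\<dots> = bline lGV" by (rule bline_scale) simp
  finally show ?thesis .
qed

text \<open>The barycentric coordinates of the foot \<open>D = (0 : q : r)\<close> have sum \<open>q + r\<close>. Scaling the source
coordinates by these sums removes all denominators from the two affine maps, which then become
\<open>TP_coords\<close> and \<open>TP'_coords\<close>.\<close>

definition foot_scale :: "real^3 \<Rightarrow> real^3" where
  "foot_scale w = vector [(q + r) * w$1, (r + p) * w$2, (p + q) * w$3]"

definition TP_coords :: "real^3 \<Rightarrow> real^3" where
  "TP_coords w = vector [p * (w$2 + w$3), q * (w$3 + w$1), r * (w$1 + w$2)]"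

definition TP'_coords :: "real^3 \<Rightarrow> real^3" where
  "TP'_coords w = vector [r * w$2 + q * w$3, p * w$3 + r * w$1, q * w$1 + p * w$2]"

lemma linear_TP_coords: "linear TP_coords"
  by (rule linearI) (simp_all add: TP_coords_def vec3_eq_iff algebra_simps)

lemma linear_TP'_coords: "linear TP'_coords"
  by (rule linearI) (simp_all add: TP'_coords_def vec3_eq_iff algebra_simps)

lemma foot_scale_cases: obtains w where "u = foot_scale w"
proof
  show "u = foot_scale (vector [u$1 / (q + r), u$2 / (r + p), u$3 / (p + q)])"
    using off_anti by (simp add: foot_scale_def vec3_eq_iff)
qed

lemma foot_scale_eq_0_iff: "foot_scale w = 0 \<longleftrightarrow> w = 0"
  using off_anti by (simp add: foot_scale_def vec3_eq_iff)

lemma TP_coords_eq_0_iff: "TP_coords w = 0 \<longleftrightarrow> w = 0"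
  using off_sides by (simp add: TP_coords_def vec3_eq_iff) linarith

lemma inj_TP_coords: "inj TP_coords"
  using linear_injective_0[OF linear_TP_coords] TP_coords_eq_0_iff by blast

lemma TP_coords_cases: obtains w where "u = TP_coords w"
  using linear_inj_imp_surj[OF linear_TP_coords inj_TP_coords] by (metis surjD)

lemma TP'_coords_eq_0_iff: "TP'_coords w = 0 \<longleftrightarrow> w = 0"
proof
  assume "TP'_coords w = 0"
  then have e: "r * w$2 + q * w$3 = 0" "p * w$3 + r * w$1 = 0" "q * w$1 + p * w$2 = 0"
    by (simp_all add: TP'_coords_def vec3_eq_iff)
  have "2 * q * r * w$1 = 0" "2 * r * p * w$2 = 0" "2 * p * q * w$3 = 0" using e by algebra+
  then show "w = 0" using off_sides by (simp add: vec3_eq_iff)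
qed (simp add: TP'_coords_def vec3_eq_iff)

text \<open>The vector of \<open>T\<^sub>P(GV)\<close> is defined by this property: pulled back along \<open>T\<^sub>P\<close>, it is the vector of \<open>GV\<close>
up to a factor.\<close>

lemma lTGV_TP_coords: "lTGV \<bullet> TP_coords w = (2 * p * q * r) * (lGV \<bullet> foot_scale w)"
  by (simp add: lTGV_def lGV_def TP_coords_def foot_scale_def inner_vec3) algebra

text \<open>On the line at infinity the condition for a fixed point is one quadratic equation. It is diagonal in
\<open>w\<close>, and by the next lemma it is the equation of the conic.\<close>

lemma fixed_infinite:
  assumes "(q + r) * w$1 + (r + p) * w$2 + (p + q) * w$3 = 0"
  shows "TP_coords w \<times> TP'_coords w = (((q\<^sup>2 - r\<^sup>2) * (w$1)\<^sup>2 + (r\<^sup>2 - p\<^sup>2) * (w$2)\<^sup>2 + (p\<^sup>2 - q\<^sup>2) * (w$3)\<^sup>2) / 2)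
    *\<^sub>R vector [1, 1, 1]" (is "_ = (?B / 2) *\<^sub>R _")
proof -
  let ?s = "(q + r) * w$1 + (r + p) * w$2 + (p + q) * w$3"
  \<comment> \<open>The cofactors of the coordinate sum result from comparing coefficients; each component is a
    cyclic shift of the previous one.\<close>
  have "2 * (TP_coords w \<times> TP'_coords w)$1 = ?B + ?s * ((q - r) * w$1 + (p - r) * w$2 + (q - p) * w$3)"
    "2 * (TP_coords w \<times> TP'_coords w)$2 = ?B + ?s * ((r - p) * w$2 + (q - p) * w$3 + (r - q) * w$1)"
    "2 * (TP_coords w \<times> TP'_coords w)$3 = ?B + ?s * ((p - q) * w$3 + (r - q) * w$1 + (p - r) * w$2)"
    by (simp_all add: TP_coords_def TP'_coords_def cross_components; algebra)+
  then show ?thesis unfolding assms by (simp add: vec3_eq_iff)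
qed

text \<open>The mixed terms cancel because \<open>(w\<^sub>3 + w\<^sub>1)(w\<^sub>1 + w\<^sub>2)\<close> is \<open>w\<^sub>1\<^sup>2\<close> plus a symmetric expression and the
coefficients \<open>q\<^sup>2 - r\<^sup>2\<close>, \<open>r\<^sup>2 - p\<^sup>2\<close>, \<open>p\<^sup>2 - q\<^sup>2\<close> have sum zero.\<close>

lemma conic_TP_coords: "conic_coeffs \<bullet> pair_prods (TP_coords w) = - (p * q * r)\<^sup>2 *
    ((q\<^sup>2 - r\<^sup>2) * (w$1)\<^sup>2 + (r\<^sup>2 - p\<^sup>2) * (w$2)\<^sup>2 + (p\<^sup>2 - q\<^sup>2) * (w$3)\<^sup>2)"
  by (simp add: conic_coeffs_eq pair_prods_def TP_coords_def inner_vec3) algebra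

lemma sum_TP_coords: "vector [1, 1, 1] \<bullet> TP_coords w = (q + r) * w$1 + (r + p) * w$2 + (p + q) * w$3"
  "vector [1, 1, 1] \<bullet> TP'_coords w = (q + r) * w$1 + (r + p) * w$2 + (p + q) * w$3"
  by (simp_all add: TP_coords_def TP'_coords_def inner_vec3 algebra_simps)

lemma fixed_if_center:
  assumes w: "w \<noteq> 0" and Z: "bary (TP_coords w) = bary uZ"
  shows "bary (TP'_coords w) = bary (TP_coords w)"
proof -
  \<comment> \<open>The solution of \<open>(q - r) w\<^sub>1 = (r - p) w\<^sub>2 = (p - q) w\<^sub>3\<close>, cleared of denominators and scaled
    so that its image is exactly \<open>uZ\<close>.\<close>
  define v :: "real^3" where "v = vector [(r - p) * (q - p), (p - q) * (r - q), (q - r) * (p - r)]"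
  have v: "TP_coords v = uZ" "TP'_coords v = uZ"
    by (simp_all add: TP_coords_def TP'_coords_def uZ_def v_def vec3_eq_iff; algebra)+
  have nz: "TP_coords w \<noteq> 0" using w by (simp add: TP_coords_eq_0_iff)
  obtain c where "TP_coords w = c *\<^sub>R uZ"
    using Z bary_eq_iff[OF vectors_nonzero(5) nz] cross_eq_0_iff_scaleR[OF vectors_nonzero(5) nz] by metis
  then have "TP_coords w = TP_coords (c *\<^sub>R v)" using v by (simp add: linear_scale[OF linear_TP_coords])
  then have "w = c *\<^sub>R v" by (rule injD[OF inj_TP_coords])
  then have "TP'_coords w = TP_coords w" using v by (simp add: linear_scale[OF linear_TP_coords] linear_scale[OF linear_TP'_coords])
  then show ?thesis by simp
qed

text \<open>The two cases are an infinite and an ordinary point; the coordinate sum, which both vectors share,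
decides between them and fixes the factor of proportionality to 1 in the ordinary case.\<close>

lemma fixed_iff:
  assumes w: "w \<noteq> 0"
  shows "bary (TP'_coords w) = bary (TP_coords w) \<longleftrightarrow> bary (TP_coords w) = bary uZ \<or> bary (TP_coords w) \<in> circumconic conic_coeffs \<inter> line_inf"
proof -
  have nz: "TP_coords w \<noteq> 0" "TP'_coords w \<noteq> 0" using w by (simp_all add: TP_coords_eq_0_iff TP'_coords_eq_0_iff)
  show ?thesis
  proof (cases "(q + r) * w$1 + (r + p) * w$2 + (p + q) * w$3 = 0")
    case True
    then have inf: "bary (TP_coords w) \<in> line_inf"
      using nz by (simp add: line_inf_eq bary_in_bline_iff sum_TP_coords)
    let ?B = "(q\<^sup>2 - r\<^sup>2) * (w$1)\<^sup>2 + (r\<^sup>2 - p\<^sup>2) * (w$2)\<^sup>2 + (p\<^sup>2 - q\<^sup>2) * (w$3)\<^sup>2"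
    have "vector [1, 1, 1] \<noteq> (0 :: real^3)" by (simp add: vec3_eq_iff)
    then have "bary (TP_coords w) = bary (TP'_coords w) \<longleftrightarrow> ?B = 0"
      unfolding bary_eq_iff[OF nz] fixed_infinite[OF True] by simp
    moreover have "bary (TP_coords w) \<in> circumconic conic_coeffs \<longleftrightarrow> ?B = 0"
      unfolding bary_in_circumconic_iff[OF nz(1)] conic_TP_coords using off_sides by simp
    moreover have "bary (TP_coords w) = bary uZ \<Longrightarrow> bary (TP'_coords w) = bary (TP_coords w)"
      using fixed_if_center[OF w] by metis
    ultimately show ?thesis using inf by (metis IntI IntD1)
  next
    case False
    then have "bary (TP_coords w) \<notin> line_inf"
      using nz by (simp add: line_inf_eq bary_in_bline_iff sum_TP_coords)
    moreover have "bary (TP_coords w) = bary uZ" if fixed: "bary (TP'_coords w) = bary (TP_coords w)"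
    proof -
      obtain c where c: "TP'_coords w = c *\<^sub>R TP_coords w"
        using fixed bary_eq_iff[OF nz] cross_eq_0_iff_scaleR[OF nz] by metis
      have "vector [1, 1, 1] \<bullet> TP'_coords w = c * (vector [1, 1, 1] \<bullet> TP_coords w)" by (simp add: c)
      with False have "c = 1" by (simp add: sum_TP_coords)
      with c have "TP'_coords w = TP_coords w" by simp
      then have e: "(q - r) * w$1 = (r - p) * w$2" "(r - p) * w$2 = (p - q) * w$3"
        by (simp_all add: TP_coords_def TP'_coords_def vec3_eq_iff algebra_simps)
      have "TP_coords w \<times> uZ = 0"
      proof -
        have "discr *\<^sub>R TP_coords w = (- ((q - r) * w$1)) *\<^sub>R uZ"
          using e by (simp add: TP_coords_def uZ_def discr_def vec3_eq_iff) algebra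
        then have "discr *\<^sub>R (TP_coords w \<times> uZ) = 0"
          by (metis cross_mult_left cross_refl scaleR_zero_right)
        then show ?thesis using discr_nonzero by simp
      qed
      then show ?thesis by (simp add: bary_eq_iff nz vectors_nonzero)
    qed
    moreover have "bary (TP_coords w) = bary uZ \<Longrightarrow> bary (TP'_coords w) = bary (TP_coords w)"
      using fixed_if_center[OF w] by metis
    ultimately show ?thesis by (metis IntD2)
  qed
qed

end

section \<open>The configuration in barycentric coordinates\<close>

context triangle begin

lemma join_sides:
  "join (pt B) (pt C) = bline (vector [1, 0, 0])"
  "join (pt C) (pt A) = bline (vector [0, 1, 0])"
  "join (pt A) (pt B) = bline (vector [0, 0, 1])"
proof -
  have e: "vector [0, 1, 0] \<times> vector [0, 0, 1] = (vector [1, 0, 0] :: real^3)"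
    "vector [0, 0, 1] \<times> vector [1, 0, 0] = (vector [0, 1, 0] :: real^3)"
    "vector [1, 0, 0] \<times> vector [0, 1, 0] = (vector [0, 0, 1] :: real^3)"
    by (simp_all add: coords)
  show "join (pt B) (pt C) = bline (vector [1, 0, 0])"
    "join (pt C) (pt A) = bline (vector [0, 1, 0])"
    "join (pt A) (pt B) = bline (vector [0, 0, 1])"
    unfolding vertices_bary by (subst join_bary, simp_all only: e; simp add: vec3_eq_iff)+
qed

lemma join_vertex:
  assumes "u$2 \<noteq> 0 \<or> u$3 \<noteq> 0"
  shows "join (pt A) (bary u) = bline (vector [0, - u$3, u$2])"
proof -
  have e: "vector [1, 0, 0] \<times> u = vector [0, - u$3, u$2]" by (simp add: coords)
  show ?thesis
    unfolding vertices_bary using assms by (subst join_bary, simp_all only: e) (auto simp: vec3_eq_iff)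
qed

lemma trace_bary:
  assumes "u$2 \<noteq> 0 \<or> u$3 \<noteq> 0"
  shows "trace_pt A B C (bary u) = bary (vector [0, u$2, u$3])"
  unfolding trace_pt_def join_vertex[OF assms] join_sides
  by (rule meet_bline_eqI) (use assms in \<open>auto simp: coords\<close>)

lemma affine_map_point_refl: "affine_map (\<lambda>x. a - x)"
  by (simp add: affine_map_def linear_iff)

lemma refl_trace_bary:
  assumes "u$2 \<noteq> 0 \<or> u$3 \<noteq> 0"
  shows "refl_trace A B C (bary u) = bary (vector [0, u$3, u$2])"
proof -
  have h: "hom (B + C - A) = bary_hom (vector [-1, 1, 1])" "hom (B + C - B) = bary_hom (vector [0, 0, 1])"
      "hom (B + C - C) = bary_hom (vector [0, 1, 0])"
    by (simp_all add: bary_hom_def hom_def vec3_eq_iff)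
  let ?v = "vector [0, u$2, u$3] :: real^3"
  have "?v \<noteq> 0" using assms by (auto simp: vec3_eq_iff)
  then have "refl_trace A B C (bary u) = bary (?v$1 *\<^sub>R vector [-1, 1, 1] + ?v$2 *\<^sub>R vector [0, 0, 1] + ?v$3 *\<^sub>R vector [0, 1, 0])"
    unfolding refl_trace_def trace_bary[OF assms] by (rule extend_affine_bary[OF affine_map_point_refl h])
  also have "?v$1 *\<^sub>R vector [-1, 1, 1] + ?v$2 *\<^sub>R vector [0, 0, 1] + ?v$3 *\<^sub>R vector [0, 1, 0] = (vector [0, u$3, u$2] :: real^3)"
    by (simp add: vec3_eq_iff)
  finally show ?thesis .
qed

text \<open>The definitions for the sides \<open>CA\<close> and \<open>AB\<close> arise from the one for \<open>BC\<close> by permuting the vertices. Read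
in the rotated frame \<open>BCA\<close>, the lemmas about the vertex \<open>A\<close> give those about \<open>B\<close>, and these in turn
those about \<open>C\<close>.\<close>

lemma rotate: "triangle B C A"
  using noncollinear by unfold_locales (simp add: insert_commute)

lemma bary_rotate: "triangle.bary B C A u = bary (vector [u$3, u$1, u$2])"
  by (simp add: bary_def triangle.bary_def[OF rotate] bary_hom_def triangle.bary_hom_def[OF rotate] add.commute add.left_commute)

lemma bary_rotate': "bary u = triangle.bary B C A (vector [u$2, u$3, u$1])"
  by (simp add: bary_rotate)

lemma bline_rotate: "triangle.bline B C A n = bline (vector [n$3, n$1, n$2])"
proof -
  interpret R: triangle B C A by (rule rotate)
  have "R.bary u \<in> R.bline n \<longleftrightarrow> R.bary u \<in> bline (vector [n$3, n$1, n$2])" if u: "u \<noteq> 0" for u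
  proof -
    have "vector [u$3, u$1, u$2] \<noteq> (0 :: real^3)" using u by (auto simp: vec3_eq_iff)
    then show ?thesis
      unfolding R.bary_in_bline_iff[OF u] by (auto simp: bary_rotate bary_in_bline_iff inner_vec3)
  qed
  then show ?thesis by (metis R.bary_cases set_eqI)
qed

lemma join_vertex_B:
  assumes "u$3 \<noteq> 0 \<or> u$1 \<noteq> 0"
  shows "join (pt B) (bary u) = bline (vector [u$3, 0, - u$1])"
  using triangle.join_vertex[OF rotate, of "vector [u$2, u$3, u$1]"] assms
  by (simp add: bary_rotate'[of u] bline_rotate)

lemma traces_B:
  assumes "u$3 \<noteq> 0 \<or> u$1 \<noteq> 0"
  shows "trace_pt B C A (bary u) = bary (vector [u$1, 0, u$3])"
    "refl_trace B C A (bary u) = bary (vector [u$3, 0, u$1])"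
  using triangle.trace_bary[OF rotate, of "vector [u$2, u$3, u$1]"]
    triangle.refl_trace_bary[OF rotate, of "vector [u$2, u$3, u$1]"] assms
  by (simp_all add: bary_rotate)

end

context triangle begin

lemma join_vertex_C:
  assumes "u$1 \<noteq> 0 \<or> u$2 \<noteq> 0"
  shows "join (pt C) (bary u) = bline (vector [- u$2, u$1, 0])"
  using triangle.join_vertex_B[OF rotate, of "vector [u$2, u$3, u$1]"] assms
  by (simp add: bary_rotate'[of u] bline_rotate)

lemma traces_C:
  assumes "u$1 \<noteq> 0 \<or> u$2 \<noteq> 0"
  shows "trace_pt C A B (bary u) = bary (vector [u$1, u$2, 0])"
    "refl_trace C A B (bary u) = bary (vector [u$2, u$1, 0])"
  using triangle.traces_B[OF rotate, of "vector [u$2, u$3, u$1]"] assms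
  by (simp_all add: bary_rotate)

text \<open>The three lines are \<open>q y = r z\<close>, \<open>r z = p x\<close> and \<open>p x = q y\<close> for the point \<open>(p : q : r)\<close>.\<close>

lemma isotomic_bary:
  assumes "u$1 \<noteq> 0" "u$2 \<noteq> 0" "u$3 \<noteq> 0"
  shows "isotomic A B C (bary u) = bary (pair_prods u)"
proof -
  have pp: "pair_prods u \<noteq> 0" using assms by (simp add: pair_prods_def vec3_eq_iff)
  have l: "join (pt A) (refl_trace A B C (bary u)) = bline (vector [0, - u$2, u$3])"
    "join (pt B) (refl_trace B C A (bary u)) = bline (vector [u$1, 0, - u$3])"
    "join (pt C) (refl_trace C A B (bary u)) = bline (vector [- u$1, u$2, 0])"
    using assms by (simp_all add: refl_trace_bary traces_B traces_C join_vertex join_vertex_B join_vertex_C)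
  let ?m = "vector [0, - u$2, u$3] \<times> vector [u$1, 0, - u$3]"
  have m: "?m = pair_prods u" by (simp add: pair_prods_def coords)
  then have "bline (vector [0, - u$2, u$3]) \<inter> bline (vector [u$1, 0, - u$3]) = {bary (pair_prods u)}"
    using bline_Int[of "vector [0, - u$2, u$3]" "vector [u$1, 0, - u$3]"] pp by simp
  moreover have "bary (pair_prods u) \<in> bline (vector [- u$1, u$2, 0])"
    by (simp add: bary_in_bline_iff[OF pp]) (simp add: pair_prods_def inner_vec3)
  ultimately show ?thesis
    unfolding isotomic_def l by (intro the_equality) blast+
qed

lemma compl_map_vertices:
  "affine_map (compl_map A B C)"
  "hom (compl_map A B C A) = bary_hom (vector [0, 1/2, 1/2])"
  "hom (compl_map A B C B) = bary_hom (vector [1/2, 0, 1/2])"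
  "hom (compl_map A B C C) = bary_hom (vector [1/2, 1/2, 0])"
proof -
  have "(\<lambda>x. compl_map A B C x - compl_map A B C 0) = (\<lambda>x. (-1/2) *\<^sub>R x)"
    by (simp add: compl_map_def homothety_def algebra_simps)
  then show "affine_map (compl_map A B C)" by (simp add: affine_map_def linear_iff algebra_simps)
qed (simp_all add: compl_map_def homothety_def centroid_def bary_hom_def hom_def vec3_eq_iff algebra_simps)

lemma extend_compl_map:
  assumes "u \<noteq> 0"
  shows "extend_affine (compl_map A B C) (bary u) = bary (vector [u$2 + u$3, u$3 + u$1, u$1 + u$2])"
proof -
  have "extend_affine (compl_map A B C) (bary u) =
      bary (u$1 *\<^sub>R vector [0, 1/2, 1/2] + u$2 *\<^sub>R vector [1/2, 0, 1/2] + u$3 *\<^sub>R vector [1/2, 1/2, 0])"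
    by (rule extend_affine_bary[OF compl_map_vertices assms])
  also have "\<dots> = bary ((1/2) *\<^sub>R vector [u$2 + u$3, u$3 + u$1, u$1 + u$2])"
    by (rule arg_cong[of _ _ bary]) (simp add: vec3_eq_iff)
  finally show ?thesis by (simp add: bary_scale)
qed

lemma pt_centroid: "pt (centroid A B C) = bary (vector [1, 1, 1])"
proof -
  have "pt (centroid A B C) = bary ((1/3) *\<^sub>R vector [1, 1, 1])"
    by (subst bary_eq_pt) (simp_all add: centroid_def algebra_simps)
  then show ?thesis by (simp add: bary_scale)
qed

lemma inv_compl_map:
  "inv (compl_map A B C) A = B + C - A"
  "inv (compl_map A B C) B = C + A - B"
  "inv (compl_map A B C) C = A + B - C"
proof -
  have inj: "inj (compl_map A B C)" by (rule injI) (simp add: compl_map_def homothety_def)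
  show "inv (compl_map A B C) A = B + C - A"
    "inv (compl_map A B C) B = C + A - B"
    "inv (compl_map A B C) C = A + B - C"
    by (rule inv_f_eq[OF inj], simp add: compl_map_def homothety_def centroid_def vec_eq_iff field_simps)+
qed

lemma off_side_lines_iff:
  assumes "u \<noteq> 0"
  shows "bary u \<notin> side_lines A B C \<longleftrightarrow> u$1 \<noteq> 0 \<and> u$2 \<noteq> 0 \<and> u$3 \<noteq> 0"
  using assms by (simp add: side_lines_def join_sides bary_in_bline_iff inner_vec3)

lemma off_medians_iff:
  assumes "u \<noteq> 0"
  shows "bary u \<notin> medians A B C \<longleftrightarrow> u$1 \<noteq> u$2 \<and> u$2 \<noteq> u$3 \<and> u$3 \<noteq> u$1"
  using assms by (auto simp: medians_def Let_def pt_centroid join_vertex join_vertex_B join_vertex_C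
      bary_in_bline_iff inner_vec3)

lemma off_anticomplementary_iff:
  assumes "u \<noteq> 0"
  defines "K \<equiv> compl_map A B C"
  shows "bary u \<notin> side_lines (inv K A) (inv K B) (inv K C)
    \<longleftrightarrow> u$2 + u$3 \<noteq> 0 \<and> u$3 + u$1 \<noteq> 0 \<and> u$1 + u$2 \<noteq> 0"
proof -
  have v: "pt (inv K A) = bary (vector [-1, 1, 1])" "pt (inv K B) = bary (vector [1, -1, 1])"
    "pt (inv K C) = bary (vector [1, 1, -1])"
    by (simp_all add: K_def inv_compl_map bary_eq_pt algebra_simps)
  have e: "vector [1, -1, 1] \<times> vector [1, 1, -1] = (2 *\<^sub>R vector [0, 1, 1] :: real^3)"
    "vector [1, 1, -1] \<times> vector [-1, 1, 1] = (2 *\<^sub>R vector [1, 0, 1] :: real^3)"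
    "vector [-1, 1, 1] \<times> vector [1, -1, 1] = (2 *\<^sub>R vector [1, 1, 0] :: real^3)"
    by (simp_all add: coords)
  have nz: "(2 *\<^sub>R vector [0, 1, 1] :: real^3) \<noteq> 0" "(2 *\<^sub>R vector [1, 0, 1] :: real^3) \<noteq> 0"
    "(2 *\<^sub>R vector [1, 1, 0] :: real^3) \<noteq> 0"
    by (simp_all add: vec3_eq_iff)
  show ?thesis
    unfolding side_lines_def v
    using assms(1) nz by (simp add: join_bary e bline_scale bary_in_bline_iff inner_vec3 conj_ac add.commute)
qed

end

context cevian begin

definition "TP = affine_to A B C (trace_pt A B C (bary uP)) (trace_pt B C A (bary uP)) (trace_pt C A B (bary uP))"
definition "TP' = affine_to A B C (refl_trace A B C (bary uP)) (refl_trace B C A (bary uP)) (refl_trace C A B (bary uP))"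

lemma isotomic_P: "isotomic A B C (bary uP) = bary uP'"
  using off_sides isotomic_bary[of uP] by (simp add: uP_def pair_prods_def uP'_def)

lemma compl_P: "extend_affine (compl_map A B C) (bary uP) = bary uQ'"
  using extend_compl_map[OF vectors_nonzero(1)] by (simp add: uP_def uQ'_def)

lemma compl_P': "extend_affine (compl_map A B C) (bary uP') = bary uQ"
  using extend_compl_map[OF vectors_nonzero(2)] by (simp add: uP'_def uQ_def algebra_simps)

lemma TP:
  "affine_map TP" "hom_map TP (bary_hom (foot_scale w)) = bary_hom (TP_coords w)"
proof -
  let ?D = "vector [0, q / (q + r), r / (q + r)] :: real^3"
  let ?E = "vector [p / (r + p), 0, r / (r + p)] :: real^3"
  let ?F = "vector [p / (p + q), q / (p + q), 0] :: real^3"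
  have "bary (vector [0, q, r]) = bary ?D"
    by (rule bary_eqI[of _ "q + r"]) (use off_anti in \<open>simp_all add: vec3_eq_iff\<close>)
  moreover have "bary (vector [p, 0, r]) = bary ?E"
    by (rule bary_eqI[of _ "r + p"]) (use off_anti in \<open>simp_all add: vec3_eq_iff\<close>)
  moreover have "bary (vector [p, q, 0]) = bary ?F"
    by (rule bary_eqI[of _ "p + q"]) (use off_anti in \<open>simp_all add: vec3_eq_iff\<close>)
  ultimately have TP: "TP = affine_to A B C (bary ?D) (bary ?E) (bary ?F)"
    using off_sides by (simp add: TP_def trace_bary traces_B traces_C uP_def)
  have s: "?D$1 + ?D$2 + ?D$3 = 1" "?E$1 + ?E$2 + ?E$3 = 1" "?F$1 + ?F$2 + ?F$3 = 1"
    using off_anti by (simp_all add: add_divide_distrib[symmetric] add.commute)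
  note T = affine_to_bary[OF s, folded TP]
  show "affine_map TP" by (rule T)
  have "foot_scale w $ 1 *\<^sub>R ?D + foot_scale w $ 2 *\<^sub>R ?E + foot_scale w $ 3 *\<^sub>R ?F = TP_coords w"
    using off_anti by (simp add: foot_scale_def TP_coords_def vec3_eq_iff) (simp add: algebra_simps)
  then show "hom_map TP (bary_hom (foot_scale w)) = bary_hom (TP_coords w)"
    unfolding hom_map_bary_hom[OF T] by simp
qed

lemma TP':
  "affine_map TP'" "hom_map TP' (bary_hom (foot_scale w)) = bary_hom (TP'_coords w)"
proof -
  let ?D = "vector [0, r / (q + r), q / (q + r)] :: real^3"
  let ?E = "vector [r / (r + p), 0, p / (r + p)] :: real^3"
  let ?F = "vector [q / (p + q), p / (p + q), 0] :: real^3"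
  have "bary (vector [0, r, q]) = bary ?D"
    by (rule bary_eqI[of _ "q + r"]) (use off_anti in \<open>simp_all add: vec3_eq_iff\<close>)
  moreover have "bary (vector [r, 0, p]) = bary ?E"
    by (rule bary_eqI[of _ "r + p"]) (use off_anti in \<open>simp_all add: vec3_eq_iff\<close>)
  moreover have "bary (vector [q, p, 0]) = bary ?F"
    by (rule bary_eqI[of _ "p + q"]) (use off_anti in \<open>simp_all add: vec3_eq_iff\<close>)
  ultimately have TP: "TP' = affine_to A B C (bary ?D) (bary ?E) (bary ?F)"
    using off_sides by (simp add: TP'_def refl_trace_bary traces_B traces_C uP_def)
  have s: "?D$1 + ?D$2 + ?D$3 = 1" "?E$1 + ?E$2 + ?E$3 = 1" "?F$1 + ?F$2 + ?F$3 = 1"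
    using off_anti by (simp_all add: add_divide_distrib[symmetric] add.commute)
  note T = affine_to_bary[OF s, folded TP]
  show "affine_map TP'" by (rule T)
  have "foot_scale w $ 1 *\<^sub>R ?D + foot_scale w $ 2 *\<^sub>R ?E + foot_scale w $ 3 *\<^sub>R ?F = TP'_coords w"
    using off_anti by (simp add: foot_scale_def TP'_coords_def vec3_eq_iff)
  then show "hom_map TP' (bary_hom (foot_scale w)) = bary_hom (TP'_coords w)"
    unfolding hom_map_bary_hom[OF T] by simp
qed

lemma TP_bary:
  assumes "w \<noteq> 0"
  shows "extend_affine TP (bary (foot_scale w)) = bary (TP_coords w)"
  using assms by (simp add: bary_def extend_affine_abs TP bary_hom_eq_0_iff foot_scale_eq_0_iff)

lemma TP_image_GV: "extend_affine TP ` bline lGV = bline lTGV"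
proof (intro set_eqI iffI)
  fix X assume "X \<in> extend_affine TP ` bline lGV"
  then obtain u where u: "u \<noteq> 0" "lGV \<bullet> u = 0" "X = extend_affine TP (bary u)" by (auto simp: bline_def)
  obtain w where w: "u = foot_scale w" by (rule foot_scale_cases)
  then have "w \<noteq> 0" using u by (simp add: foot_scale_eq_0_iff)
  then show "X \<in> bline lTGV"
    using u by (simp add: w TP_bary bary_in_bline_iff TP_coords_eq_0_iff lTGV_TP_coords)
next
  fix X assume "X \<in> bline lTGV"
  then obtain u where u: "u \<noteq> 0" "lTGV \<bullet> u = 0" "X = bary u" by (auto simp: bline_def)
  obtain w where w: "u = TP_coords w" by (rule TP_coords_cases)
  then have nz: "w \<noteq> 0" using u by (simp add: TP_coords_eq_0_iff)
  have "bary (foot_scale w) \<in> bline lGV"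
    using u off_sides nz by (simp add: w lTGV_TP_coords bary_in_bline_iff foot_scale_eq_0_iff)
  moreover have "X = extend_affine TP (bary (foot_scale w))" by (simp add: TP_bary nz u w)
  ultimately show "X \<in> extend_affine TP ` bline lGV" by blast
qed

lemma inj_TP: "inj TP"
proof (rule injI)
  fix x y assume "TP x = TP y"
  obtain u v where uv: "hom x = bary_hom u" "hom y = bary_hom v" using surj_bary_hom by (metis surjD)
  obtain a b where ab: "u = foot_scale a" "v = foot_scale b" by (metis foot_scale_cases)
  have "hom_map TP (hom x) = hom_map TP (hom y)" using \<open>TP x = TP y\<close> by (simp add: hom_map_hom)
  then have "TP_coords a = TP_coords b" by (simp add: uv ab TP bary_hom_eq_iff)
  then have "a = b" by (rule injD[OF inj_TP_coords])
  then have "hom x = hom y" by (simp add: uv ab)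
  then show "x = y" by (simp add: hom_inj)
qed

text \<open>The homogeneous map of the composition agrees on the three vertices with the one of the second affine
map, hence everywhere, since the vertices form a basis.\<close>

lemma lam_bary:
  assumes "w \<noteq> 0"
  shows "extend_affine (TP' \<circ> inv TP) (bary (TP_coords w)) = bary (TP'_coords w)"
proof -
  note a = affine_map_comp[OF TP'(1) affine_map_inv[OF TP(1) inj_TP]]
  note L = linear_hom_map[OF a] linear_hom_map[OF TP(1)] linear_hom_map[OF TP'(1)]
  have "hom_map (TP' \<circ> inv TP) (hom_map TP (hom x)) = hom_map TP' (hom x)" for x
    by (simp add: hom_map_hom inv_f_f[OF inj_TP])
  then have "hom_map (TP' \<circ> inv TP) (hom_map TP (bary_hom u)) = hom_map TP' (bary_hom u)" for u
    by (simp add: bary_hom_def linear_add[OF L(1)] linear_add[OF L(2)] linear_add[OF L(3)]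
        linear_scale[OF L(1)] linear_scale[OF L(2)] linear_scale[OF L(3)])
  from this[of "foot_scale w"] have "hom_map (TP' \<circ> inv TP) (bary_hom (TP_coords w)) = bary_hom (TP'_coords w)"
    by (simp add: TP TP')
  then show ?thesis
    using assms by (simp add: bary_def extend_affine_abs[OF a] bary_hom_eq_0_iff TP_coords_eq_0_iff)
qed

lemma lam_fixed_points:
  "{X. extend_affine (TP' \<circ> inv TP) X = X} = {bary uZ} \<union> (circumconic conic_coeffs \<inter> line_inf)"
proof (rule set_eqI)
  fix X
  obtain u where u: "u \<noteq> 0" "X = bary u" by (rule bary_cases)
  obtain w where w: "u = TP_coords w" by (rule TP_coords_cases)
  then have nz: "w \<noteq> 0" using u by (simp add: TP_coords_eq_0_iff)
  show "X \<in> {X. extend_affine (TP' \<circ> inv TP) X = X} \<longleftrightarrow> X \<in> {bary uZ} \<union> (circumconic conic_coeffs \<inter> line_inf)"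
    using fixed_iff[OF nz] by (simp add: u w lam_bary nz)
qed

end

unbundle no cross3_syntax

theorem theorem4p1:
  fixes A B C P :: "real^2"
    and K :: "real^2 \<Rightarrow> real^2"
    and P' Q Q' G V Z :: epoint
    and T\<^sub>P T\<^sub>P' :: "real^2 \<Rightarrow> real^2"
    and lam :: "epoint \<Rightarrow> epoint"
    and \<C> :: "epoint set"
  assumes "\<not> collinear {A, B, C}"
    and "K = compl_map A B C"
    and "pt P \<notin> side_lines A B C"
    and "pt P \<notin> side_lines (inv K A) (inv K B) (inv K C)"
    and "pt P \<notin> medians A B C"
    and "P' = isotomic A B C (pt P)"
    and "ordinary P'"
    and "G = pt (centroid A B C)"
    and "Q = extend_affine K P'"
    and "Q' = extend_affine K (pt P)"
    and "V = meet (join (pt P) Q) (join P' Q')"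
    and "T\<^sub>P = affine_to A B C
           (trace_pt A B C (pt P)) (trace_pt B C A (pt P)) (trace_pt C A B (pt P))"
    and "T\<^sub>P' = affine_to A B C
           (refl_trace A B C (pt P)) (refl_trace B C A (pt P)) (refl_trace C A B (pt P))"
    and "lam = extend_affine (T\<^sub>P' \<circ> inv T\<^sub>P)"
    and "\<C> = conic_through {pt A, pt B, pt C, pt P, Q}"
    and "Z = conic_center \<C>"
  shows "join G V \<noteq> extend_affine T\<^sub>P ` join G V \<and>
         Z = meet (join G V) (extend_affine T\<^sub>P ` join G V) \<and>
         (is_parabola \<C> \<or> is_ellipse \<C> \<longrightarrow> {X. lam X = X} = {Z}) \<and>
         (is_hyperbola \<C> \<longrightarrow>
            {X. lam X = X} = {Z} \<union> {X \<in> line_inf. \<exists>l. asymptote \<C> l \<and> X \<in> l})"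
proof -
  interpret triangle A B C by unfold_locales (rule assms(1))
  obtain u where u: "u$1 + u$2 + u$3 = 1" "pt P = bary u" by (rule pt_cases)
  have "u \<noteq> 0" using u(1) by auto
  have sides: "u$1 \<noteq> 0" "u$2 \<noteq> 0" "u$3 \<noteq> 0"
    using assms(3) \<open>u \<noteq> 0\<close> by (auto simp: u(2) off_side_lines_iff)
  have P': "P' = bary (pair_prods u)" using assms(6) sides by (simp add: u(2) isotomic_bary)
  have pp: "pair_prods u \<noteq> 0" using sides by (simp add: pair_prods_def vec3_eq_iff)
  have "u$2 * u$3 + u$3 * u$1 + u$1 * u$2 \<noteq> 0"
    using assms(7) pp by (simp add: P' ordinary_def line_inf_eq bary_in_bline_iff)
      (simp add: pair_prods_def inner_vec3)
  then interpret cevian A B C "u$1" "u$2" "u$3"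
    using u(1) sides assms(2,4,5) \<open>u \<noteq> 0\<close>
    by unfold_locales (auto simp: u(2) off_anticomplementary_iff off_medians_iff)
  have uP: "uP = u" by (simp add: uP_def vec3_eq_iff)
  have P: "pt P = bary uP" by (simp add: uP u(2))
  have P': "P' = bary uP'" using assms(6) isotomic_P by (simp add: P)
  have Q: "Q = bary uQ" "Q' = bary uQ'" using assms(2,9,10) by (simp_all add: P P' compl_P compl_P')
  have GV: "join G V = bline lGV"
    using assms(8,11) by (simp add: P P' Q meet_PQ_P'Q' pt_centroid join_GV)
  have T: "T\<^sub>P = TP" "T\<^sub>P' = TP'" using assms(12,13) by (simp_all add: P TP_def TP'_def)
  have \<C>: "\<C> = circumconic conic_coeffs" using assms(15) by (simp add: P Q conic_through_five_points)
  have Z: "Z = bary uZ" using assms(16) by (simp add: \<C> center)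
  have fixed: "{X. lam X = X} = {Z} \<union> (\<C> \<inter> line_inf)"
    using lam_fixed_points assms(14) by (simp add: T Z \<C>)
  \<comment> \<open>For a parabola the only infinite point of the conic is its center; an ellipse has none.\<close>
  have "\<C> \<inter> line_inf \<subseteq> {Z}" if "is_parabola \<C> \<or> is_ellipse \<C>"
    using that parabola_center assms(16) by (auto simp: is_ellipse_def \<C>)
  moreover have "{X \<in> line_inf. \<exists>l. asymptote \<C> l \<and> X \<in> l} = \<C> \<inter> line_inf" if "is_hyperbola \<C>"
    using hyperbola_asymptotes that unfolding \<C> by blast
  moreover have "bline lGV \<noteq> bline lTGV" using lGV_cross_lTGV_nonzero by (rule bline_neqI)
  ultimately show ?thesis
    unfolding fixed by (simp add: GV T TP_image_GV meet_GV_TGV Z[symmetric])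
qed

end
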